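(* (i) For every $k\ge5$, the classes $\mathfrak{L}(\mathbf{H})^w_{O(n)}$ and $\mathfrak{L}(\mathbb{Z}^k)^w_{O(n)}$ are incomparable (neither contains the other). (ii) The classes $\mathfrak{L}(\mathbf{H})^w_{O(n)}$ and $\mathsf{CF}$ are incomparable.
   Context: For a group $G$ with identity $e$, a $G$-automaton is a tuple $(Q,\Sigma,G,\delta,q_0,Q_a)$ where $Q$ is a finite set of states, $\Sigma$ a finite input alphabet, $q_0\in Q$ the initial state, $Q_a\subseteq Q$ the accepting states, and $\delta$ assigns to each $(q,\sigma)\in Q\times(\Sigma\cup\{\varepsilon\})$ a finite set of pairs $(q',m)\in Q\times G$. The register holds an element of $G$, initially $e$; using a transition $(q',m)\in\delta(q,\sigma)$ (one step) the automaton reads $\sigma$ (or nothing), moves to $q'$ and replaces the register content $x$ by $xm$. A word is accepted if some computation reads it entirely and ends in an accepting state with register equal to $e$. A $G$-automaton recognizing $\mathtt{L}$ is weakly $t(n)$ time-bounded if every $x\in\mathtt{L}$ with $|x|=n$ has an accepting computation of at most $t(n)$ steps; $\mathfrak{L}(G)^w_{O(n)}$ is the class of languages recognized by weakly $t(n)$ time-bounded $G$-automata for some $t(n)=O(n)$. $\mathbf{H}$ is the discrete Heisenberg group of $3\times3$ upper unitriangular integer matrices; $\mathbb{Z}^k$ is the free Abelian group of rank $k$; $\mathsf{CF}$ is the class of context-free languages. *)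

theory Defs
  imports "HOL-Algebra.Group" "HOL-Library.Landau_Symbols"
begin

text \<open>A G-automaton (Q, Sigma, G, delta, q0, Qa). States are natural numbers,
  input letters are of type 'a; the group G is a HOL-Algebra group.
  delta q None are the epsilon transitions, delta q (Some s) those reading s.\<close>

record ('a, 'g) gautomaton =
  states :: "nat set"
  alphabet :: "'a set"
  trans :: "nat \<Rightarrow> 'a option \<Rightarrow> (nat \<times> 'g) set"
  init :: nat
  accepting :: "nat set"

definition wf_gautomaton :: "('g, 'b) monoid_scheme \<Rightarrow> ('a, 'g) gautomaton \<Rightarrow> bool" where
  "wf_gautomaton G A \<longleftrightarrow>
     finite (states A) \<and> finite (alphabet A) \<and>
     init A \<in> states A \<and> accepting A \<subseteq> states A \<and>
     (\<forall>q s. finite (trans A q s)) \<and>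
     (\<forall>q s. trans A q s \<noteq> {} \<longrightarrow>
         q \<in> states A \<and> (case s of None \<Rightarrow> True | Some a \<Rightarrow> a \<in> alphabet A)) \<and>
     (\<forall>q s. trans A q s \<subseteq> states A \<times> carrier G)"

inductive comp :: "('g, 'b) monoid_scheme \<Rightarrow> ('a, 'g) gautomaton \<Rightarrow>
    nat \<Rightarrow> 'g \<Rightarrow> 'a list \<Rightarrow> nat \<Rightarrow> 'g \<Rightarrow> nat \<Rightarrow> bool"
  for G A where
  comp_nil: "comp G A q x [] q x 0"
| comp_read: "(q', m) \<in> trans A q (Some a) \<Longrightarrow> comp G A q' (x \<otimes>\<^bsub>G\<^esub> m) w q'' y n
      \<Longrightarrow> comp G A q x (a # w) q'' y (Suc n)"
| comp_eps: "(q', m) \<in> trans A q None \<Longrightarrow> comp G A q' (x \<otimes>\<^bsub>G\<^esub> m) w q'' y n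
      \<Longrightarrow> comp G A q x w q'' y (Suc n)"

definition accepts_in :: "('g, 'b) monoid_scheme \<Rightarrow> ('a, 'g) gautomaton \<Rightarrow> 'a list \<Rightarrow> nat \<Rightarrow> bool" where
  "accepts_in G A w n \<longleftrightarrow>
     (\<exists>q. q \<in> accepting A \<and> comp G A (init A) \<one>\<^bsub>G\<^esub> w q \<one>\<^bsub>G\<^esub> n)"

definition accepts :: "('g, 'b) monoid_scheme \<Rightarrow> ('a, 'g) gautomaton \<Rightarrow> 'a list \<Rightarrow> bool" where
  "accepts G A w \<longleftrightarrow> (\<exists>n. accepts_in G A w n)"

definition recognizes :: "('g, 'b) monoid_scheme \<Rightarrow> ('a, 'g) gautomaton \<Rightarrow> 'a list set \<Rightarrow> bool" where
  "recognizes G A L \<longleftrightarrow> L = {w \<in> lists (alphabet A). accepts G A w}"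

definition weakly_time_bounded ::
    "('g, 'b) monoid_scheme \<Rightarrow> ('a, 'g) gautomaton \<Rightarrow> 'a list set \<Rightarrow> (nat \<Rightarrow> nat) \<Rightarrow> bool" where
  "weakly_time_bounded G A L t \<longleftrightarrow> (\<forall>w\<in>L. \<exists>n. n \<le> t (length w) \<and> accepts_in G A w n)"

definition lin_time_class :: "('g, 'b) monoid_scheme \<Rightarrow> 'a list set set" where
  "lin_time_class G = {L. \<exists>A t. wf_gautomaton G A \<and> recognizes G A L \<and>
       weakly_time_bounded G A L t \<and> (\<lambda>n. real (t n)) \<in> O(\<lambda>n. real n)}"

definition mat3_mult :: "(nat \<Rightarrow> nat \<Rightarrow> int) \<Rightarrow> (nat \<Rightarrow> nat \<Rightarrow> int) \<Rightarrow> nat \<Rightarrow> nat \<Rightarrow> int" where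
  "mat3_mult M N = (\<lambda>i j. if i < 3 \<and> j < 3 then (\<Sum>k<3. M i k * N k j) else 0)"

definition mat3_one :: "nat \<Rightarrow> nat \<Rightarrow> int" where
  "mat3_one = (\<lambda>i j. if i < 3 \<and> j < 3 \<and> i = j then 1 else 0)"

definition heisenberg :: "(nat \<Rightarrow> nat \<Rightarrow> int) monoid" where
  "heisenberg = \<lparr>carrier = {M. (\<forall>i j. (3 \<le> i \<or> 3 \<le> j) \<longrightarrow> M i j = 0) \<and>
                             (\<forall>i<3. M i i = 1) \<and> (\<forall>i<3. \<forall>j<i. M i j = 0)},
                 mult = mat3_mult, one = mat3_one\<rparr>"

definition Zk :: "nat \<Rightarrow> (nat \<Rightarrow> int) monoid" where
  "Zk k = \<lparr>carrier = {f. \<forall>i\<ge>k. f i = 0}, mult = (\<lambda>f g i. f i + g i), one = (\<lambda>_. 0)\<rparr>"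

inductive cfg_step :: "(nat \<times> (nat + 'a) list) set \<Rightarrow> (nat + 'a) list \<Rightarrow> (nat + 'a) list \<Rightarrow> bool"
  for P where
  "(A, rhs) \<in> P \<Longrightarrow> cfg_step P (u @ [Inl A] @ v) (u @ rhs @ v)"

definition cfg_lang :: "(nat \<times> (nat + 'a) list) set \<Rightarrow> nat \<Rightarrow> 'a list set" where
  "cfg_lang P S = {w. (cfg_step P)\<^sup>*\<^sup>* [Inl S] (map Inr w)}"

definition CF :: "'a list set set" where
  "CF = {L. \<exists>P S. finite P \<and> L = cfg_lang P S}"

end

(* In the Heisenberg group, x^(2a) y^b (x^-2 y^-1 z)^c z^-d = 1 exactly if a = b = c and d = c^2, so the
   words 0^n 1^n 2^n 3^(n^2) form a real-time H-language whose lengths n^2 + 3n contain no infinite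
   arithmetic progression. Infinite sets of word lengths of Z^k-automata and of context-free
   languages do contain one: for Z^k, split accepting walks into a simple walk and short cycles,
   compare two of them by Dickson's lemma, and pump the difference; for context-free languages,
   pump a derivation tree.
   Conversely, in linear time an H-automaton reaches only O(n^4) register contents, since the corner
   entry grows quadratically and the other two linearly. Languages with more mutually
   non-exchangeable prefixes are therefore out of reach: sorted words testing five equalities
   (about n^5 prefixes) for Z^5, and marked palindromes (2^n prefixes) for CF. *)

theory Submission
  imports Defs "HOL-Library.Function_Algebras" "HOL-Library.Product_Plus" "HOL-Library.Multiset"
    "HOL-Library.Infinite_Set" "HOL-Library.FuncSet"
begin

text \<open>A cycle of a Z^k-automaton cannot be repeated on its own, since its register weight need
  not vanish. What can be repeated is the excess of one accepting walk over another: both have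
  register weight 0, hence so has their difference. Two obstacles shape the argument. A cycle
  removed by loop erasure may be based at a vertex that the remaining simple walk no longer meets;
  cycles are therefore referred to the vertices of the original walk and put back there. And epsilon
  steps allow nonempty cycles that read nothing; weights therefore count letters, and the compared
  walks have strictly increasing word lengths. The threshold 5 is the first exponent beyond 4 = 1 +
  1 + 2, the growth degrees of the three entries of a Heisenberg matrix added up.\<close>

definition has_progression :: "nat set \<Rightarrow> bool" where
  "has_progression X \<longleftrightarrow> (\<exists>b d. d > 0 \<and> (\<forall>m. b + m * d \<in> X))"

section \<open>Walks in weighted graphs\<close>

fun walk :: "'s \<Rightarrow> ('s \<times> 'w \<times> 's) list \<Rightarrow> 's \<Rightarrow> bool" where
  "walk p [] q \<longleftrightarrow> p = q"
| "walk p ((a, _, b) # es) q \<longleftrightarrow> p = a \<and> walk b es q"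

definition visited :: "'s \<Rightarrow> ('s \<times> 'w \<times> 's) list \<Rightarrow> 's set" where
  "visited p es = insert p ((snd \<circ> snd) ` set es)"

text \<open>Commutativity of the weights is what makes the place irrelevant at which a cycle is cut
  out or spliced in.\<close>

definition weight :: "('s \<times> 'w::comm_monoid_add \<times> 's) list \<Rightarrow> 'w" where
  "weight es = sum_list (map (fst \<circ> snd) es)"

lemma weight_simps [simp]:
  "weight [] = 0" "weight ((a, w, b) # es) = w + weight es"
  "weight (es @ fs) = weight es + weight fs"
  by (simp_all add: weight_def)

lemma visited_simps [simp]:
  "visited p [] = {p}" "visited p ((a, w, b) # es) = insert p (visited b es)"
  by (auto simp: visited_def)

lemma walk_append: "walk p (es @ fs) q \<longleftrightarrow> (\<exists>r. walk p es r \<and> walk r fs q)"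
  by (induction es arbitrary: p) auto

lemma walk_target_visited: "walk p es q \<Longrightarrow> q \<in> visited p es"
  by (induction es arbitrary: p) auto

lemma visited_append: "walk p es r \<Longrightarrow> visited p (es @ fs) = visited p es \<union> visited r fs"
  using walk_target_visited[of p es r] by (auto simp: visited_def)

lemma walk_split_at:
  assumes "walk p es q" "s \<in> visited p es"
  shows "\<exists>as bs. es = as @ bs \<and> walk p as s \<and> walk s bs q"
  using assms
proof (induction es arbitrary: p)
  case (Cons e es)
  obtain a w b where e: "e = (a, w, b)" by (cases e)
  show ?case
  proof (cases "s = p")
    case True
    then show ?thesis using Cons.prems by (intro exI[of _ "[]"] exI[of _ "e # es"]) auto
  next
    case False
    then have "walk b es q" "s \<in> visited b es" using Cons.prems e by auto
    then obtain as bs where "es = as @ bs" "walk b as s" "walk s bs q"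
      using Cons.IH by blast
    then show ?thesis using Cons.prems e by (intro exI[of _ "e # as"] exI[of _ bs]) auto
  qed
qed auto

text \<open>The length bound leaves finitely many cycles, so that their multiplicities form vectors
  with finitely many coordinates. \<open>V\<close> collects the vertices at which such a cycle may
  be spliced into a walk.\<close>

definition short_cycles ::
    "('s \<times> 'w \<times> 's) set \<Rightarrow> 's set \<Rightarrow> ('s \<times> 'w \<times> 's) list set" where
  "short_cycles E V = {\<gamma>. set \<gamma> \<subseteq> E \<and> length \<gamma> \<le> Suc (card E) \<and> (\<exists>s\<in>V. walk s \<gamma> s)}"

definition simple_walk :: "('s \<times> 'w \<times> 's) set \<Rightarrow> 's \<Rightarrow> ('s \<times> 'w \<times> 's) list \<Rightarrow> 's \<Rightarrow> bool" where
  "simple_walk E p \<rho> q \<longleftrightarrow> walk p \<rho> q \<and> distinct (p # map (snd \<circ> snd) \<rho>) \<and> set \<rho> \<subseteq> E"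

lemma short_cycles_mono: "V \<subseteq> W \<Longrightarrow> short_cycles E V \<subseteq> short_cycles E W"
  unfolding short_cycles_def by blast

lemma simple_walk_length:
  assumes "simple_walk E p \<rho> q" "finite E"
  shows "length \<rho> \<le> card E"
proof -
  have "distinct \<rho>" "set \<rho> \<subseteq> E" using assms(1) by (simp_all add: simple_walk_def distinct_map)
  then show ?thesis using assms(2) by (metis card_mono distinct_card)
qed

text \<open>Loop erasure: the cycles cut out are short, because each consists of one edge followed
  by a piece of a walk without repeated vertices.\<close>

lemma walk_decompose:
  fixes E :: "('s \<times> 'w::comm_monoid_add \<times> 's) set"
  assumes "finite E" "walk p es q" "set es \<subseteq> E"
  shows "\<exists>\<rho> C. simple_walk E p \<rho> q \<and> visited p \<rho> \<subseteq> visited p es \<and>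
    set_mset C \<subseteq> short_cycles E (visited p es) \<and>
    weight es = weight \<rho> + (\<Sum>\<gamma>\<in>#C. weight \<gamma>)"
  using assms(2,3)
proof (induction es arbitrary: p)
  case Nil
  then show ?case by (intro exI[of _ "[]"] exI[of _ "{#}"]) (simp add: simple_walk_def)
next
  case (Cons e es)
  obtain w b where e: "e = (p, w, b)" using Cons.prems by (cases e) auto
  have "walk b es q" "set es \<subseteq> E" using Cons.prems e by auto
  then obtain \<rho> C where \<rho>: "simple_walk E b \<rho> q" "visited b \<rho> \<subseteq> visited b es"
    and C: "set_mset C \<subseteq> short_cycles E (visited b es)"
    and wt: "weight es = weight \<rho> + (\<Sum>\<gamma>\<in>#C. weight \<gamma>)"
    using Cons.IH by meson
  have C': "set_mset C \<subseteq> short_cycles E (visited p (e # es))"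
    using C short_cycles_mono[of "visited b es" "visited p (e # es)" E] by (auto simp: e)
  have len: "length \<rho> \<le> card E" using \<rho>(1) assms(1) by (rule simple_walk_length)
  have \<rho>': "walk b \<rho> q" "distinct (b # map (snd \<circ> snd) \<rho>)" "set \<rho> \<subseteq> E"
    using \<rho>(1) by (simp_all add: simple_walk_def)
  show ?case
  proof (cases "p \<in> visited b \<rho>")
    case True
    then obtain as bs where ab: "\<rho> = as @ bs" "walk b as p" "walk p bs q"
      using walk_split_at \<rho>'(1) by meson
    have p: "p \<in> visited b as" using ab(2) by (rule walk_target_visited)
    have "simple_walk E p bs q"
      using p \<rho>'(2,3) ab(3) unfolding ab(1) simple_walk_def visited_def by auto
    moreover have "visited p bs \<subseteq> visited p (e # es)"
      using \<rho>(2) unfolding ab(1) visited_append[OF ab(2)] by (auto simp: e)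
    \<comment> \<open>One new edge plus a piece of a simple walk: this is the origin of the bound
      \<open>Suc (card E)\<close>.\<close>
    moreover have "e # as \<in> short_cycles E (visited p (e # es))"
      using ab(2) len \<rho>'(3) Cons.prems(2) unfolding ab(1) short_cycles_def by (simp add: e)
    then have "set_mset (add_mset (e # as) C) \<subseteq> short_cycles E (visited p (e # es))"
      using C' by simp
    moreover have "weight (e # es) = weight bs + (\<Sum>\<gamma>\<in>#add_mset (e # as) C. weight \<gamma>)"
      by (simp add: e wt ab(1) ac_simps)
    ultimately show ?thesis by (intro exI conjI)
  next
    case False
    have "simple_walk E p (e # \<rho>) q"
      using False \<rho>' Cons.prems(2) by (simp add: e simple_walk_def visited_def)
    moreover have "visited p (e # \<rho>) \<subseteq> visited p (e # es)" using \<rho>(2) by (auto simp: e)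
    moreover have "weight (e # es) = weight (e # \<rho>) + (\<Sum>\<gamma>\<in>#C. weight \<gamma>)"
      by (simp add: e wt ac_simps)
    ultimately show ?thesis using C' by (intro exI conjI)
  qed
qed

text \<open>Cycles are spliced in one at a time. A splice never loses a visited vertex, so the base
  points of the remaining cycles stay available.\<close>

lemma walk_insert_cycles:
  fixes E :: "('s \<times> 'w::comm_monoid_add \<times> 's) set"
  assumes "walk p es q" "set es \<subseteq> E" "set_mset D \<subseteq> short_cycles E (visited p es)"
  shows "\<exists>fs. walk p fs q \<and> set fs \<subseteq> E \<and> visited p es \<subseteq> visited p fs \<and>
    weight fs = weight es + (\<Sum>\<gamma>\<in>#D. weight \<gamma>)"
  using assms(3)
proof (induction D)
  case empty
  then show ?case using assms by (intro exI[of _ es]) auto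
next
  case (add \<gamma> D)
  obtain fs where fs: "walk p fs q" "set fs \<subseteq> E" "visited p es \<subseteq> visited p fs"
      "weight fs = weight es + (\<Sum>\<gamma>\<in>#D. weight \<gamma>)"
    using add by auto
  obtain s where s: "s \<in> visited p es" "walk s \<gamma> s" and \<gamma>: "set \<gamma> \<subseteq> E"
    using add.prems by (auto simp: short_cycles_def)
  obtain as bs where ab: "fs = as @ bs" "walk p as s" "walk s bs q"
    using walk_split_at[OF fs(1)] s fs(3) by blast
  have "walk p (as @ \<gamma> @ bs) q" using ab s by (auto simp: walk_append)
  moreover have "visited p fs \<subseteq> visited p (as @ \<gamma> @ bs)" using ab by (auto simp: visited_def)
  ultimately show ?case using fs ab \<gamma>
    by (intro exI[of _ "as @ \<gamma> @ bs"]) (auto simp: ac_simps)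
qed

text \<open>A decreasing sequence of naturals is constant from the index of its least value on, so
  in either case of the monotone subsequence theorem a weakly increasing one results.\<close>

lemma nat_seq_mono_subseq:
  fixes s :: "nat \<Rightarrow> nat"
  shows "\<exists>r :: nat \<Rightarrow> nat. strict_mono r \<and> mono (\<lambda>n. s (r n))"
proof -
  obtain g :: "nat \<Rightarrow> nat" where g: "strict_mono g" "monoseq (\<lambda>n. s (g n))"
    using seq_monosub[of s] by (auto simp: o_def)
  show ?thesis
  proof (cases "incseq (\<lambda>n. s (g n))")
    case True
    then show ?thesis using g by auto
  next
    case False
    then have dec: "decseq (\<lambda>n. s (g n))" using g(2) by (auto simp: monoseq_iff)
    obtain N where N: "\<And>n. s (g N) \<le> s (g n)"
      using ex_has_least_nat[of "\<lambda>_. True" 0 "\<lambda>n. s (g n)"] by auto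
    have "s (g (N + n)) = s (g N)" for n
      using N[of "N + n"] decseqD[OF dec, of N "N + n"] by simp
    then have "mono (\<lambda>n. s (g (N + n)))" by (simp add: mono_def)
    moreover have "strict_mono (\<lambda>n. g (N + n))" using g(1) by (simp add: strict_mono_def)
    ultimately show ?thesis by (intro exI[of _ "\<lambda>n. g (N + n)"]) simp
  qed
qed

text \<open>Dickson's lemma for sequences: the subsequence is refined once per coordinate, and
  refining keeps the coordinates already treated monotone.\<close>

lemma dickson_subseq:
  fixes f :: "nat \<Rightarrow> 'a \<Rightarrow> nat"
  assumes "finite K"
  shows "\<exists>r :: nat \<Rightarrow> nat. strict_mono r \<and> (\<forall>x\<in>K. mono (\<lambda>n. f (r n) x))"
  using assms
proof (induction K)
  case empty
  then show ?case by (intro exI[of _ id]) (auto simp: strict_mono_def)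
next
  case (insert x K)
  then obtain r :: "nat \<Rightarrow> nat"
    where r: "strict_mono r" "\<forall>x\<in>K. mono (\<lambda>n. f (r n) x)" by blast
  obtain g :: "nat \<Rightarrow> nat" where g: "strict_mono g" "mono (\<lambda>n. f (r (g n)) x)"
    using nat_seq_mono_subseq[of "\<lambda>n. f (r n) x"] by auto
  have "mono g" using g(1) by (rule strict_mono_mono)
  then have "mono (\<lambda>n. f (r (g n)) y)" if "y \<in> K" for y
    using r(2) that by (auto simp: mono_def)
  moreover have "strict_mono (\<lambda>n. r (g n))" using r(1) g(1) by (simp add: strict_mono_def)
  ultimately show ?case using g by (intro exI[of _ "\<lambda>n. r (g n)"]) auto
qed

text \<open>The cycles of the later walk that are left over after matching those of the earlier one
  start at vertices of the later walk, so they may be inserted into it any number of times.\<close>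

lemma walk_pump:
  fixes E :: "('s \<times> 'w::comm_monoid_add \<times> 's) set"
  assumes E: "finite E" and F: "finite F"
    and \<pi>: "\<And>n. walk p (\<pi> n) (q n)" "\<And>n. set (\<pi> n) \<subseteq> E" "\<And>n. q n \<in> F"
  shows "\<exists>(i::nat) j D. i < j \<and> weight (\<pi> j) = weight (\<pi> i) + D \<and>
    (\<forall>m::nat. \<exists>es. set es \<subseteq> E \<and> walk p es (q j) \<and> weight es = weight (\<pi> j) + (\<Sum>l<m. D))"
proof -
  define K where "K = {\<gamma>. set \<gamma> \<subseteq> E \<and> length \<gamma> \<le> Suc (card E)}"
  have K: "finite K" unfolding K_def using E by (rule finite_lists_length_le)
  have "\<exists>\<rho> C. simple_walk E p \<rho> (q n) \<and> set_mset C \<subseteq> short_cycles E (visited p (\<pi> n)) \<and>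
      weight (\<pi> n) = weight \<rho> + (\<Sum>\<gamma>\<in>#C. weight \<gamma>)" for n
    using walk_decompose[OF E \<pi>(1)[of n] \<pi>(2)[of n]] by meson
  then obtain \<rho> C where \<rho>: "\<And>n. simple_walk E p (\<rho> n) (q n)"
    and C: "\<And>n. set_mset (C n) \<subseteq> short_cycles E (visited p (\<pi> n))"
    and wt: "\<And>n. weight (\<pi> n) = weight (\<rho> n) + (\<Sum>\<gamma>\<in>#C n. weight \<gamma>)"
    by metis
  have \<rho>K: "\<rho> n \<in> K" for n
    using simple_walk_length[OF \<rho> E, of n] \<rho>[of n] by (simp add: K_def simple_walk_def)
  have CK: "set_mset (C n) \<subseteq> K" for n
    using C[of n] by (auto simp: K_def short_cycles_def)
  \<comment> \<open>Only finitely many simple walks occur. Restricted to indices that share one,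
    weights differ only through the cycle multisets, which Dickson's lemma then compares.\<close>
  have "finite (range \<rho>)" using K \<rho>K by (metis finite_subset image_subsetI)
  then obtain n0 where inf: "infinite {n. \<rho> n = \<rho> n0}"
    using pigeonhole_infinite[of "UNIV :: nat set" \<rho>] by auto
  define e where "e = enumerate {n. \<rho> n = \<rho> n0}"
  have e: "\<rho> (e n) = \<rho> n0" for n
    using enumerate_in_set[OF inf, of n] by (simp add: e_def)
  obtain r :: "nat \<Rightarrow> nat" where r: "strict_mono r" "\<forall>\<gamma>\<in>K. mono (\<lambda>n. count (C (e (r n))) \<gamma>)"
    using dickson_subseq[OF K, of "\<lambda>n. count (C (e n))"] by blast
  define i where "i = e (r 0)"
  define j where "j = e (r 1)"
  have "i < j" unfolding i_def j_def e_def
    using r(1) inf by (intro enumerate_mono) (auto simp: strict_mono_def)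
  have "C i \<subseteq># C j"
  proof (rule mset_subset_eqI)
    fix \<gamma>
    show "count (C i) \<gamma> \<le> count (C j) \<gamma>"
    proof (cases "\<gamma> \<in> K")
      case True
      then show ?thesis using r(2) by (auto simp: mono_def i_def j_def)
    next
      case False
      then show ?thesis using CK[of i] by (metis not_in_iff subsetD zero_le)
    qed
  qed
  then obtain R where R: "C j = C i + R" by (metis subset_mset.add_diff_inverse)
  \<comment> \<open>Weights form only a monoid, so the difference is not obtained by subtraction but
    as the weight of the surplus cycles, and its \<open>m\<close>-fold multiple is written as a
    constant sum.\<close>
  define D where "D = (\<Sum>\<gamma>\<in>#R. weight \<gamma>)"
  have "weight (\<pi> j) = weight (\<pi> i) + D"
    by (simp add: wt R D_def ac_simps) (simp add: i_def j_def e)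
  moreover have "\<exists>es. set es \<subseteq> E \<and> walk p es (q j) \<and> weight es = weight (\<pi> j) + (\<Sum>l<m. D)" for m :: nat
  proof -
    have "(\<Sum>\<gamma>\<in>#repeat_mset m R. weight \<gamma>) = (\<Sum>l<m. D)"
      by (induction m) (auto simp: D_def ac_simps)
    moreover have "set_mset (repeat_mset m R) \<subseteq> set_mset (C j)"
    proof
      show "\<gamma> \<in># C j" if "\<gamma> \<in># repeat_mset m R" for \<gamma>
        using that by (simp add: R flip: count_greater_zero_iff)
    qed
    then have "set_mset (repeat_mset m R) \<subseteq> short_cycles E (visited p (\<pi> j))"
      using C[of j] by blast
    ultimately show ?thesis
      using walk_insert_cycles[OF \<pi>(1)[of j] \<pi>(2)[of j], of "repeat_mset m R"] by metis
  qed
  ultimately show ?thesis using \<open>i < j\<close> by blast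
qed

section \<open>Computations of group automata\<close>

definition transitions :: "('a, 'g) gautomaton \<Rightarrow> (nat \<times> 'a option \<times> nat \<times> 'g) set" where
  "transitions A = {(q, s, q', m). (q', m) \<in> trans A q s}"

lemma finite_transitions:
  assumes "wf_gautomaton G A"
  shows "finite (transitions A)"
proof -
  let ?S = "insert None (Some ` alphabet A)"
  have "transitions A \<subseteq> (SIGMA q:states A. SIGMA s:?S. trans A q s)"
  proof
    fix t assume "t \<in> transitions A"
    then obtain q s q' m where t: "t = (q, s, q', m)" "(q', m) \<in> trans A q s"
      by (auto simp: transitions_def)
    then have "q \<in> states A \<and> (case s of None \<Rightarrow> True | Some a \<Rightarrow> a \<in> alphabet A)"
      using assms unfolding wf_gautomaton_def by blast
    then show "t \<in> (SIGMA q:states A. SIGMA s:?S. trans A q s)"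
      using t by (auto split: option.splits)
  qed
  moreover have "finite (SIGMA q:states A. SIGMA s:?S. trans A q s)"
    using assms by (auto simp: wf_gautomaton_def)
  ultimately show ?thesis by (rule finite_subset)
qed

lemma comp_append:
  "comp G A q x u q' y n \<Longrightarrow> comp G A q' y v q'' z m \<Longrightarrow> comp G A q x (u @ v) q'' z (n + m)"
  by (induction rule: comp.induct) (auto intro: comp.intros)

lemma comp_split:
  "comp G A q x (u @ v) q'' z n \<Longrightarrow>
    \<exists>q' y k m. comp G A q x u q' y k \<and> comp G A q' y v q'' z m \<and> n = k + m"
proof (induction q x "u @ v" q'' z n arbitrary: u rule: comp.induct)
  case (comp_nil q x)
  then show ?case by (metis append_is_Nil_conv add_0 comp.comp_nil)
next
  case (comp_read q' m q a x w q'' y n)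
  show ?case
  proof (cases u)
    case Nil
    have "comp G A q x (a # w) q'' y (Suc n)"
      using comp_read(1,2) by (rule comp.comp_read)
    then have "comp G A q x u q x 0 \<and> comp G A q x v q'' y (Suc n) \<and> Suc n = 0 + Suc n"
      using Nil comp_read(4) by (simp add: comp.comp_nil)
    then show ?thesis by blast
  next
    case (Cons b u')
    then have "b = a" "w = u' @ v" using comp_read by auto
    then obtain q1 y1 k l where "comp G A q' (x \<otimes>\<^bsub>G\<^esub> m) u' q1 y1 k" "comp G A q1 y1 v q'' y l" "n = k + l"
      using comp_read(3) by blast
    then have "comp G A q x u q1 y1 (Suc k)" "comp G A q1 y1 v q'' y l" "Suc n = Suc k + l"
      using Cons \<open>b = a\<close> comp_read(1) by (auto intro: comp.comp_read)
    then show ?thesis by blast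
  qed
next
  case (comp_eps q' m q x q'' y n)
  then obtain q1 y1 k l where "comp G A q' (x \<otimes>\<^bsub>G\<^esub> m) u q1 y1 k" "comp G A q1 y1 v q'' y l" "n = k + l"
    by blast
  then have "comp G A q x u q1 y1 (Suc k)" "comp G A q1 y1 v q'' y l" "Suc n = Suc k + l"
    using comp_eps(1) by (auto intro: comp.comp_eps)
  then show ?case by blast
qed

lemma comp_lists_alphabet:
  assumes "wf_gautomaton G A"
  shows "comp G A q x w q' y n \<Longrightarrow> w \<in> lists (alphabet A)"
proof (induction rule: comp.induct)
  case (comp_read q' m q a x w q'' y n)
  have "\<forall>q s. trans A q s \<noteq> {} \<longrightarrow>
      q \<in> states A \<and> (case s of None \<Rightarrow> True | Some a \<Rightarrow> a \<in> alphabet A)"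
    using assms by (simp add: wf_gautomaton_def)
  from this[rule_format, of q "Some a"] have "a \<in> alphabet A" using comp_read(1) by auto
  then show ?case using comp_read.IH by simp
qed auto

lemma trans_target_state:
  assumes "wf_gautomaton G A" "(q', m) \<in> trans A q s"
  shows "q' \<in> states A" "m \<in> carrier G"
proof -
  have "trans A q s \<subseteq> states A \<times> carrier G" using assms(1) by (simp add: wf_gautomaton_def)
  then show "q' \<in> states A" "m \<in> carrier G" using assms(2) by auto
qed

lemma comp_states:
  assumes "wf_gautomaton G A"
  shows "comp G A q x w q' y n \<Longrightarrow> q \<in> states A \<Longrightarrow> q' \<in> states A"
  by (induction rule: comp.induct) (use trans_target_state(1)[OF assms] in auto)

section \<open>Word lengths of languages of free Abelian group automata\<close>

text \<open>The weight pairs the register increment with the number of letters read, so a single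
  equation between weights controls acceptance and word length together. Which letter is read is
  forgotten.\<close>

definition edges :: "('a, nat \<Rightarrow> int) gautomaton \<Rightarrow> (nat \<times> ((nat \<Rightarrow> int) \<times> nat) \<times> nat) set" where
  "edges A = (\<lambda>(q, s, q', m). (q, (m, if s = None then 0 else 1), q')) ` transitions A"

lemma Zk_mult: "x \<otimes>\<^bsub>Zk k\<^esub> y = x + y"
  by (simp add: Zk_def plus_fun_def)

lemma Zk_one: "\<one>\<^bsub>Zk k\<^esub> = 0"
  by (simp add: Zk_def zero_fun_def)

lemma comp_Zk_imp_walk:
  "comp (Zk k) A q x w q' y n \<Longrightarrow> \<exists>es. walk q es q' \<and> set es \<subseteq> edges A \<and>
    y = x + fst (weight es) \<and> length w = snd (weight es)"
proof (induction rule: comp.induct)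
  case (comp_nil q x)
  then show ?case by (intro exI[of _ "[]"]) simp
next
  case (comp_read q' m q a x w q'' y n)
  then obtain es where es: "walk q' es q''" "set es \<subseteq> edges A" "y = x + m + fst (weight es)"
      "length w = snd (weight es)"
    unfolding Zk_mult by blast
  have e: "(q, (m, 1), q') \<in> edges A"
    unfolding edges_def transitions_def
    by (rule image_eqI[of _ _ "(q, Some a, q', m)"]) (use comp_read(1) in simp_all)
  show ?case
    by (intro exI[of _ "(q, (m, 1), q') # es"]) (simp add: es e[simplified] add.assoc)
next
  case (comp_eps q' m q x w q'' y n)
  then obtain es where es: "walk q' es q''" "set es \<subseteq> edges A" "y = x + m + fst (weight es)"
      "length w = snd (weight es)"
    unfolding Zk_mult by blast
  have e: "(q, (m, 0), q') \<in> edges A"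
    unfolding edges_def transitions_def
    by (rule image_eqI[of _ _ "(q, None, q', m)"]) (use comp_eps(1) in simp_all)
  show ?case
    by (intro exI[of _ "(q, (m, 0), q') # es"]) (simp add: es e add.assoc)
qed

text \<open>Any transition behind an edge will do: the choice affects the word but neither its
  length nor the register.\<close>

lemma walk_imp_comp_Zk:
  assumes "walk q es q'" "set es \<subseteq> edges A"
  shows "\<exists>w n. comp (Zk k) A q x w q' (x + fst (weight es)) n \<and> length w = snd (weight es)"
  using assms
proof (induction es arbitrary: q x)
  case Nil
  then show ?case by (intro exI[of _ "[]"] exI[of _ 0]) (simp add: comp_nil)
next
  case (Cons e es)
  then obtain s q1 m where e: "e = (q, (m, if s = None then 0 else 1), q1)" "(q1, m) \<in> trans A q s"
    by (auto simp: edges_def transitions_def)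
  have "walk q1 es q'" "set es \<subseteq> edges A" using Cons.prems e(1) by auto
  from Cons.IH[OF this, of "x + m"] obtain w n
    where w: "comp (Zk k) A q1 (x \<otimes>\<^bsub>Zk k\<^esub> m) w q' (x + fst (weight (e # es))) n"
      "length w = snd (weight es)"
    by (auto simp only: Zk_mult e weight_simps fst_add fst_conv add.assoc)
  show ?case
  proof (cases s)
    case None
    have "comp (Zk k) A q x w q' (x + fst (weight (e # es))) (Suc n)"
      using e(2) w(1) unfolding None by (rule comp_eps)
    moreover have "length w = snd (weight (e # es))" using w(2) e None by simp
    ultimately show ?thesis by blast
  next
    case (Some a)
    have "comp (Zk k) A q x (a # w) q' (x + fst (weight (e # es))) (Suc n)"
      using e(2) w(1) unfolding Some by (rule comp_read)
    moreover have "length (a # w) = snd (weight (e # es))" using w(2) e Some by simp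
    ultimately show ?thesis by blast
  qed
qed

text \<open>Accepting walks have weight (0, word length). Enumerating the lengths in increasing
  order makes the difference \<open>D\<close> of two such walks a pair (0, d) with d > 0, and adding
  multiples of it preserves acceptance.\<close>

lemma Zk_lengths_progression:
  assumes wf: "wf_gautomaton (Zk k) A" and rec: "recognizes (Zk k) A L"
    and inf: "infinite (length ` L)"
  shows "has_progression (length ` L)"
proof -
  define X where "X = length ` L"
  have run: "\<exists>es q. q \<in> accepting A \<and> walk (init A) es q \<and> set es \<subseteq> edges A \<and> weight es = (0, enumerate X n)" for n
  proof -
    have "enumerate X n \<in> X" using inf unfolding X_def by (rule enumerate_in_set)
    then obtain w where w: "w \<in> L" "length w = enumerate X n" unfolding X_def by force
    have "accepts (Zk k) A w" using rec w(1) unfolding recognizes_def by blast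
    then obtain q t where q: "q \<in> accepting A" "comp (Zk k) A (init A) 0 w q 0 t"
      unfolding accepts_def accepts_in_def Zk_one by blast
    obtain es where es: "walk (init A) es q" "set es \<subseteq> edges A"
        "0 = 0 + fst (weight es)" "length w = snd (weight es)"
      using comp_Zk_imp_walk[OF q(2)] by blast
    have "fst (weight es) = 0" using es(3) unfolding add_0 by (rule sym)
    then have "weight es = (0, enumerate X n)" using es(4) w(2) by (metis prod.collapse)
    then show ?thesis using q(1) es(1,2) by blast
  qed
  then obtain \<pi> q where \<pi>: "\<And>n. q n \<in> accepting A" "\<And>n. walk (init A) (\<pi> n) (q n)"
      "\<And>n. set (\<pi> n) \<subseteq> edges A" "\<And>n. weight (\<pi> n) = (0, enumerate X n)"
    by metis
  have finE: "finite (edges A)" unfolding edges_def using finite_transitions[OF wf] by simp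
  have finF: "finite (accepting A)"
    using wf unfolding wf_gautomaton_def by (meson finite_subset)
  obtain i j D where "i < j \<and> weight (\<pi> j) = weight (\<pi> i) + D \<and>
      (\<forall>m::nat. \<exists>es. set es \<subseteq> edges A \<and> walk (init A) es (q j) \<and> weight es = weight (\<pi> j) + (\<Sum>l<m. D))"
    using walk_pump[where \<pi> = \<pi> and q = q, OF finE finF \<pi>(2,3,1)] by (elim exE) (rule that)
  note ij = this[THEN conjunct1] this[THEN conjunct2, THEN conjunct1]
    and pump = this[THEN conjunct2, THEN conjunct2, rule_format]
  have less: "enumerate X i < enumerate X j"
    using ij(1) inf unfolding X_def by (rule enumerate_mono)
  have "fst D = 0"
    using arg_cong[OF ij(2), of fst] by (simp only: \<pi>(4) fst_conv fst_add add_0)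
  moreover have "snd D > 0"
    using arg_cong[OF ij(2), of snd] less by (simp only: \<pi>(4) snd_conv snd_add)
  ultimately obtain d where D: "D = (0, d)" "d > 0" by (metis prod.collapse)
  have "enumerate X j + m * d \<in> X" for m
  proof -
    obtain es where es: "set es \<subseteq> edges A" "walk (init A) es (q j)"
        "weight es = weight (\<pi> j) + (\<Sum>l<m. D)"
      using pump by blast
    have wt: "fst (weight es) = 0" "snd (weight es) = enumerate X j + m * d"
      by (simp_all only: es(3) \<pi>(4) D fst_add snd_add fst_sum snd_sum fst_conv snd_conv
          sum.neutral_const add_0 sum_constant card_lessThan of_nat_id)
    obtain w t where w: "comp (Zk k) A (init A) 0 w (q j) 0 t" "length w = enumerate X j + m * d"
      using walk_imp_comp_Zk[OF es(2,1), of k 0] unfolding wt add_0 by blast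
    have "accepts (Zk k) A w"
      unfolding accepts_def accepts_in_def Zk_one using w(1) \<pi>(1) by blast
    then have "w \<in> L"
      using rec comp_lists_alphabet[OF wf w(1)] unfolding recognizes_def by blast
    then show ?thesis using w(2) unfolding X_def by (metis imageI)
  qed
  then show ?thesis using D(2) unfolding has_progression_def X_def by blast
qed

section \<open>Word lengths of context-free languages\<close>

text \<open>Derivation forests over a sentential form, recorded only by their number of leaves. This
  gives induction over trees in place of derivation sequences, where the steps of unrelated subtrees
  interleave.\<close>

inductive yields :: "(nat \<times> (nat + 'a) list) set \<Rightarrow> (nat + 'a) list \<Rightarrow> nat \<Rightarrow> bool" for P where
  yields_Nil: "yields P [] 0"
| yields_terminal: "yields P \<beta> n \<Longrightarrow> yields P (Inr a # \<beta>) (Suc n)"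
| yields_production: "(A, rhs) \<in> P \<Longrightarrow> yields P rhs m \<Longrightarrow> yields P \<beta> n \<Longrightarrow>
    yields P (Inl A # \<beta>) (m + n)"

text \<open>Derivation forests in which no path repeats a nonterminal; \<open>V\<close> collects the
  nonterminals above the forest.\<close>

inductive loopfree_yields ::
    "(nat \<times> (nat + 'a) list) set \<Rightarrow> nat set \<Rightarrow> (nat + 'a) list \<Rightarrow> nat \<Rightarrow> bool" for P where
  lf_Nil: "loopfree_yields P V [] 0"
| lf_terminal: "loopfree_yields P V \<beta> n \<Longrightarrow> loopfree_yields P V (Inr a # \<beta>) (Suc n)"
| lf_production: "(A, rhs) \<in> P \<Longrightarrow> A \<notin> V \<Longrightarrow> loopfree_yields P (insert A V) rhs m \<Longrightarrow>
    loopfree_yields P V \<beta> n \<Longrightarrow> loopfree_yields P V (Inl A # \<beta>) (m + n)"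

lemma yields_append: "yields P \<alpha> m \<Longrightarrow> yields P \<beta> n \<Longrightarrow> yields P (\<alpha> @ \<beta>) (m + n)"
  by (induction rule: yields.induct) (auto simp: add.assoc intro: yields.intros)

lemma yields_append_split:
  "yields P (\<alpha> @ \<beta>) n \<Longrightarrow> \<exists>k l. n = k + l \<and> yields P \<alpha> k \<and> yields P \<beta> l"
proof (induction \<alpha> arbitrary: n)
  case Nil
  then show ?case by (intro exI[of _ 0] exI[of _ n]) (auto intro: yields_Nil)
next
  case (Cons x \<alpha>)
  have "yields P (x # (\<alpha> @ \<beta>)) n" using Cons.prems by simp
  then show ?case
  proof cases
    case (yields_terminal n' a)
    then obtain k l where "n' = k + l" "yields P \<alpha> k" "yields P \<beta> l" using Cons.IH by blast
    then have "n = Suc k + l" "yields P (x # \<alpha>) (Suc k)" "yields P \<beta> l"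
      using yields_terminal by (auto intro: yields.intros)
    then show ?thesis by blast
  next
    case (yields_production A rhs m n')
    then obtain k l where "n' = k + l" "yields P \<alpha> k" "yields P \<beta> l" using Cons.IH by blast
    then have "n = (m + k) + l" "yields P (x # \<alpha>) (m + k)" "yields P \<beta> l"
      using yields_production by (auto intro: yields.intros)
    then show ?thesis by blast
  qed
qed

lemma derivation_imp_yields:
  assumes "(cfg_step P)\<^sup>*\<^sup>* \<alpha> (map Inr w)"
  shows "yields P \<alpha> (length w)"
  using assms
proof (induction rule: converse_rtranclp_induct)
  case base
  show ?case by (induction w) (auto intro: yields.intros)
next
  case (step \<alpha> \<beta>)
  from step(1) obtain A rhs u v where s: "(A, rhs) \<in> P" "\<alpha> = u @ [Inl A] @ v" "\<beta> = u @ rhs @ v"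
    by (auto elim: cfg_step.cases)
  obtain k l' where kl: "length w = k + l'" "yields P u k" "yields P (rhs @ v) l'"
    using yields_append_split[of P u "rhs @ v"] step.IH unfolding s(3) by metis
  obtain l m where lm: "l' = l + m" "yields P rhs l" "yields P v m"
    using yields_append_split[OF kl(3)] by metis
  have "yields P ([Inl A] @ v) l'"
    using yields_production[OF s(1) lm(2,3)] by (simp add: lm(1))
  then show ?case unfolding s(2) kl(1) by (rule yields_append[OF kl(2)])
qed

lemma cfg_steps_context:
  "(cfg_step P)\<^sup>*\<^sup>* \<alpha> \<beta> \<Longrightarrow> (cfg_step P)\<^sup>*\<^sup>* (u @ \<alpha> @ v) (u @ \<beta> @ v)"
proof (induction rule: rtranclp_induct)
  case (step \<beta> \<gamma>)
  from step(2) obtain A rhs x y where s: "(A, rhs) \<in> P" "\<beta> = x @ [Inl A] @ y" "\<gamma> = x @ rhs @ y"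
    by (auto elim: cfg_step.cases)
  have "cfg_step P ((u @ x) @ [Inl A] @ (y @ v)) ((u @ x) @ rhs @ (y @ v))"
    by (rule cfg_step.intros) (fact s(1))
  then have "cfg_step P (u @ \<beta> @ v) (u @ \<gamma> @ v)" using s by simp
  then show ?case using step.IH by (metis rtranclp.rtrancl_into_rtrancl)
qed simp

lemma yields_imp_derivation:
  "yields P \<alpha> n \<Longrightarrow> \<exists>w. length w = n \<and> (cfg_step P)\<^sup>*\<^sup>* \<alpha> (map Inr w)"
proof (induction rule: yields.induct)
  case yields_Nil
  then show ?case by auto
next
  case (yields_terminal \<beta> n a)
  then obtain w where "length w = n" "(cfg_step P)\<^sup>*\<^sup>* \<beta> (map Inr w)" by blast
  then show ?case using cfg_steps_context[of P \<beta> "map Inr w" "[Inr a]" "[]"]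
    by (intro exI[of _ "a # w"]) auto
next
  case (yields_production A rhs m \<beta> n)
  then obtain u v where u: "length u = m" "(cfg_step P)\<^sup>*\<^sup>* rhs (map Inr u)"
    and v: "length v = n" "(cfg_step P)\<^sup>*\<^sup>* \<beta> (map Inr v)" by blast
  have "cfg_step P (Inl A # \<beta>) (rhs @ \<beta>)"
    using cfg_step.intros[OF yields_production(1), of "[]" \<beta>] by simp
  also have "(cfg_step P)\<^sup>*\<^sup>* \<dots> (map Inr u @ \<beta>)"
    using cfg_steps_context[OF u(2), of "[]" \<beta>] by simp
  also have "(cfg_step P)\<^sup>*\<^sup>* \<dots> (map Inr u @ map Inr v)"
    using cfg_steps_context[OF v(2), of "map Inr u" "[]"] by simp
  finally show ?case using u v by (intro exI[of _ "u @ v"]) auto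
qed

section \<open>Derivation trees without repeated nonterminals on a path\<close>

lemma loopfree_yields_antimono:
  "loopfree_yields P V \<alpha> n \<Longrightarrow> W \<subseteq> V \<Longrightarrow> loopfree_yields P W \<alpha> n"
proof (induction arbitrary: W rule: loopfree_yields.induct)
  case (lf_production A rhs V m \<beta> n)
  have "loopfree_yields P (insert A W) rhs m" "loopfree_yields P W \<beta> n" "A \<notin> W"
    using lf_production.IH(1)[OF insert_mono[OF lf_production.prems]]
      lf_production.IH(2)[OF lf_production.prems] lf_production.prems lf_production(2) by auto
  then show ?case using lf_production(1) by (intro loopfree_yields.lf_production)
qed (auto intro: loopfree_yields.intros)

lemma loopfree_yields_append:
  "loopfree_yields P V \<alpha> m \<Longrightarrow> loopfree_yields P V \<beta> n \<Longrightarrow> loopfree_yields P V (\<alpha> @ \<beta>) (m + n)"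
  by (induction rule: loopfree_yields.induct) (auto simp: add.assoc intro: loopfree_yields.intros)

lemma loopfree_yields_imp_yields: "loopfree_yields P V \<alpha> n \<Longrightarrow> yields P \<alpha> n"
  by (induction rule: loopfree_yields.induct) (auto intro: yields.intros)

text \<open>Descending through a production moves its left-hand side into \<open>V\<close>, so the
  number of left-hand sides outside \<open>V\<close> drops; this is the outer induction. The inner
  one runs along the sentential form.\<close>

lemma finite_loopfree_yields:
  assumes "finite P"
  shows "finite {n. loopfree_yields P V \<alpha> n}"
proof (induction "card (fst ` P - V)" arbitrary: V \<alpha> rule: less_induct)
  case less
  show ?case
  proof (induction \<alpha>)
    case Nil
    have "{n. loopfree_yields P V [] n} \<subseteq> {0}" by (auto elim: loopfree_yields.cases)
    then show ?case by (rule finite_subset) simp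
  next
    case (Cons x \<beta>)
    show ?case
    proof (cases x)
      case (Inr a)
      have "{n. loopfree_yields P V (x # \<beta>) n} \<subseteq> Suc ` {n. loopfree_yields P V \<beta> n}"
        unfolding Inr by (auto elim: loopfree_yields.cases)
      then show ?thesis using Cons.IH by (metis finite_imageI finite_subset)
    next
      case (Inl A)
      define R where "R = {rhs \<in> snd ` P. (A, rhs) \<in> P \<and> A \<notin> V}"
      have finR: "finite R" using assms by (simp add: R_def)
      have "finite {n. loopfree_yields P (insert A V) rhs n}" if "rhs \<in> R" for rhs
      proof (rule less)
        have "A \<in> fst ` P - V" using that by (force simp: R_def)
        then show "card (fst ` P - insert A V) < card (fst ` P - V)"
          using assms by (intro psubset_card_mono) auto
      qed
      then have fin: "finite (\<Union>rhs\<in>R. {n. loopfree_yields P (insert A V) rhs n})"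
        using finR by blast
      have "{n. loopfree_yields P V (x # \<beta>) n} \<subseteq> (\<lambda>(m, n). m + n) `
          ((\<Union>rhs\<in>R. {n. loopfree_yields P (insert A V) rhs n}) \<times> {n. loopfree_yields P V \<beta> n})"
      proof
        fix n assume "n \<in> {n. loopfree_yields P V (x # \<beta>) n}"
        then have "loopfree_yields P V (Inl A # \<beta>) n" using Inl by simp
        then show "n \<in> (\<lambda>(m, n). m + n) `
          ((\<Union>rhs\<in>R. {n. loopfree_yields P (insert A V) rhs n}) \<times> {n. loopfree_yields P V \<beta> n})"
          by cases (force simp: R_def)
      qed
      then show ?thesis using fin Cons.IH by (metis finite_SigmaI finite_imageI finite_subset)
    qed
  qed
qed

text \<open>If no subtree has root \<open>A\<close>, then \<open>A\<close> may be forbidden as well.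
  Otherwise such a subtree with \<open>m\<close> letters is cut out, \<open>c\<close> letters remain
  around it, and every other yield of \<open>A\<close> can be plugged into the hole.\<close>

lemma loopfree_yields_avoid:
  "loopfree_yields P V \<alpha> n \<Longrightarrow> loopfree_yields P (insert A V) \<alpha> n \<or>
    (\<exists>m c. n = m + c \<and> loopfree_yields P {} [Inl A] m \<and>
      (\<forall>m'. yields P [Inl A] m' \<longrightarrow> yields P \<alpha> (m' + c)))"
proof (induction rule: loopfree_yields.induct)
  case (lf_Nil V)
  then show ?case by (auto intro: loopfree_yields.intros)
next
  case (lf_terminal V \<beta> n a)
  from lf_terminal.IH show ?case
  proof
    assume "\<exists>m c. n = m + c \<and> loopfree_yields P {} [Inl A] m \<and>
      (\<forall>m'. yields P [Inl A] m' \<longrightarrow> yields P \<beta> (m' + c))"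
    then obtain m c where "n = m + c" "loopfree_yields P {} [Inl A] m"
      "\<And>m'. yields P [Inl A] m' \<Longrightarrow> yields P \<beta> (m' + c)" by blast
    then show ?thesis
      by (intro disjI2 exI[of _ m] exI[of _ "Suc c"]) (auto intro: yields.intros)
  qed (auto intro: loopfree_yields.intros)
next
  case (lf_production B rhs V m \<beta> n)
  have y: "yields P rhs m" "yields P \<beta> n"
    using lf_production by (blast intro: loopfree_yields_imp_yields)+
  show ?case
  proof (cases "B = A")
    case True
    \<comment> \<open>Forgetting the ancestors above this node makes its subtree a loop-free tree in
      its own right.\<close>
    have "loopfree_yields P {B} rhs m"
      using lf_production(3) by (rule loopfree_yields_antimono) auto
    then have "loopfree_yields P {} [Inl A] m"
      using loopfree_yields.lf_production[OF lf_production(1), of "{}" m "[]" 0] True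
      by (auto intro: lf_Nil)
    moreover have "\<forall>m'. yields P [Inl A] m' \<longrightarrow> yields P (Inl B # \<beta>) (m' + n)"
      using yields_append[OF _ y(2), of "[Inl A]"] True by auto
    ultimately show ?thesis by blast
  next
    case False
    consider (both) "loopfree_yields P (insert A (insert B V)) rhs m" "loopfree_yields P (insert A V) \<beta> n"
      | (left) k c where "m = k + c" "loopfree_yields P {} [Inl A] k"
          "\<And>m'. yields P [Inl A] m' \<Longrightarrow> yields P rhs (m' + c)"
      | (right) k c where "n = k + c" "loopfree_yields P {} [Inl A] k"
          "\<And>m'. yields P [Inl A] m' \<Longrightarrow> yields P \<beta> (m' + c)"
      using lf_production.IH by blast
    then show ?thesis
    proof cases
      case both
      then show ?thesis using lf_production(1,2) False
        by (auto intro!: loopfree_yields.lf_production simp: insert_commute)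
    next
      case left
      have "yields P (Inl B # \<beta>) (m' + (c + n))" if "yields P [Inl A] m'" for m'
        using yields_production[OF lf_production(1) left(3)[OF that] y(2)] by (simp add: add.assoc)
      then show ?thesis using left by (intro disjI2 exI[of _ k] exI[of _ "c + n"]) auto
    next
      case right
      have "yields P (Inl B # \<beta>) (m' + (m + c))" if "yields P [Inl A] m'" for m'
        using yields_production[OF lf_production(1) y(1) right(3)[OF that]] by (simp add: ac_simps)
      then show ?thesis using right by (intro disjI2 exI[of _ k] exI[of _ "m + c"]) auto
    qed
  qed
qed

text \<open>Carries a progression from a part of a tree to the whole: the letters outside that part
  add a constant.\<close>

lemma has_progression_shift:
  assumes "has_progression X" "\<And>x. x \<in> X \<Longrightarrow> x + c \<in> Y"
  shows "has_progression Y"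
proof -
  obtain b d where "d > 0" and bd: "\<And>m. b + m * d \<in> X" using assms(1) by (auto simp: has_progression_def)
  have "(b + c) + m * d \<in> Y" for m
    using assms(2)[OF bd[of m]] by (simp add: ac_simps)
  with \<open>d > 0\<close> show ?thesis by (auto simp: has_progression_def)
qed

text \<open>A tree whose proper subtrees are loop-free and in which the root symbol recurs either has
  a loop that produces letters, or can be replaced by the subtree at the recurrence.\<close>

lemma yields_loopfree_or_progression:
  "yields P \<alpha> n \<Longrightarrow> loopfree_yields P {} \<alpha> n \<or> has_progression {n. yields P \<alpha> n}"
proof (induction rule: yields.induct)
  case yields_Nil
  then show ?case by (auto intro: lf_Nil)
next
  case (yields_terminal \<beta> n a)
  then show ?case
    using has_progression_shift[of "{n. yields P \<beta> n}" 1 "{n. yields P (Inr a # \<beta>) n}"]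
    by (auto intro: lf_terminal yields.intros)
next
  case (yields_production A rhs m \<beta> n)
  have single: "yields P [Inl A] k" if "yields P rhs k" for k
    using yields.yields_production[OF yields_production(1) that yields_Nil] by simp
  have from_single: "has_progression {n. yields P (Inl A # \<beta>) n}"
    if "has_progression {n. yields P [Inl A] n}"
    using that by (rule has_progression_shift[where c = n])
      (use yields_append[OF _ yields_production(3), of "[Inl A]"] in auto)
  consider (rhs) "has_progression {n. yields P rhs n}" | (tail) "has_progression {n. yields P \<beta> n}"
    | (lf) "loopfree_yields P {} rhs m" "loopfree_yields P {} \<beta> n"
    using yields_production.IH by blast
  then show ?case
  proof cases
    case rhs
    then have "has_progression {n. yields P [Inl A] n}"
      by (rule has_progression_shift[where c = 0]) (use single in auto)
    then show ?thesis using from_single by blast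
  next
    case tail
    then have "has_progression {n. yields P (Inl A # \<beta>) n}"
      by (rule has_progression_shift[where c = m])
        (use yields.yields_production[OF yields_production(1,2)] in \<open>auto simp: add.commute\<close>)
    then show ?thesis by blast
  next
    case lf
    consider (avoid) "loopfree_yields P {A} rhs m"
      | (loop) k c where "m = k + c" "loopfree_yields P {} [Inl A] k"
          "\<And>m'. yields P [Inl A] m' \<Longrightarrow> yields P rhs (m' + c)"
      using loopfree_yields_avoid[OF lf(1), of A] by blast
    then show ?thesis
    proof cases
      case avoid
      then show ?thesis using lf yields_production(1) by (auto intro: lf_production)
    next
      case loop
      show ?thesis
      proof (cases "c = 0")
        case True
        then show ?thesis using loopfree_yields_append[OF loop(2) lf(2)] loop(1) by simp
      next
        case False
        have "yields P [Inl A] (k + i * c)" for i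
        proof (induction i)
          case 0
          then show ?case using loop(2) by (simp add: loopfree_yields_imp_yields)
        next
          case (Suc i)
          then show ?case using single[OF loop(3)[OF Suc.IH]] by (simp add: ac_simps)
        qed
        then have "has_progression {n. yields P [Inl A] n}"
          using False by (auto simp: has_progression_def)
        then show ?thesis using from_single by blast
      qed
    qed
  qed
qed

text \<open>Loop-free trees account for finitely many lengths only, so an infinite set of lengths
  contains one that forces the progression.\<close>

lemma CF_lengths_progression:
  assumes "L \<in> CF" "infinite (length ` L)"
  shows "has_progression (length ` L)"
proof -
  obtain P S where P: "finite P" "L = cfg_lang P S" using assms(1) by (auto simp: CF_def)
  have X: "length ` L = {n. yields P [Inl S] n}"
    using derivation_imp_yields[of P "[Inl S]"] yields_imp_derivation[of P "[Inl S]"]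
    by (force simp: P(2) cfg_lang_def)
  have "\<not> length ` L \<subseteq> {n. loopfree_yields P {} [Inl S] n}"
    using assms(2) finite_loopfree_yields[OF P(1)] finite_subset by blast
  then show ?thesis using yields_loopfree_or_progression unfolding X by blast
qed

section \<open>Linear-time Heisenberg automata have few configurations\<close>

definition heis :: "int \<Rightarrow> int \<Rightarrow> int \<Rightarrow> nat \<Rightarrow> nat \<Rightarrow> int" where
  "heis a b c = (\<lambda>i j. if i = j \<and> i < 3 then 1 else if (i, j) = (0, 1) then a
     else if (i, j) = (1, 2) then b else if (i, j) = (0, 2) then c else 0)"

lemma less_3_cases: "(i::nat) < 3 \<longleftrightarrow> i = 0 \<or> i = 1 \<or> i = 2"
  by auto

lemma heis_carrier: "heis a b c \<in> carrier heisenberg"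
  by (auto simp: heis_def heisenberg_def)

lemma carrier_heisenberg: "carrier heisenberg = {heis a b c | a b c. True}"
proof -
  have "M = heis (M 0 1) (M 1 2) (M 0 2)" if "M \<in> carrier heisenberg" for M
  proof (intro ext)
    fix i j
    have M: "\<And>i j. 3 \<le> i \<or> 3 \<le> j \<Longrightarrow> M i j = 0" "\<And>i. i < 3 \<Longrightarrow> M i i = 1" "\<And>i j. i < 3 \<Longrightarrow> j < i \<Longrightarrow> M i j = 0"
      using that by (auto simp: heisenberg_def)
    show "M i j = heis (M 0 1) (M 1 2) (M 0 2) i j"
    proof (cases "i < 3 \<and> j < 3")
      case True
      then show ?thesis using M(2)[of i] M(3)[of i j] by (auto simp: less_3_cases heis_def)
    qed (use M(1) in \<open>auto simp: heis_def\<close>)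
  qed
  then show ?thesis using heis_carrier by blast
qed

lemma heis_mult: "heis a b c \<otimes>\<^bsub>heisenberg\<^esub> heis a' b' c' = heis (a + a') (b + b') (c + c' + a * b')"
proof (intro ext)
  fix i j
  show "(heis a b c \<otimes>\<^bsub>heisenberg\<^esub> heis a' b' c') i j = heis (a + a') (b + b') (c + c' + a * b') i j"
  proof (cases "i < 3 \<and> j < 3")
    case True
    then show ?thesis
      by (auto simp: less_3_cases heis_def heisenberg_def mat3_mult_def numeral_3_eq_3)
  qed (auto simp: heis_def heisenberg_def mat3_mult_def)
qed

lemma heis_one: "\<one>\<^bsub>heisenberg\<^esub> = heis 0 0 0"
  by (intro ext) (auto simp: heis_def heisenberg_def mat3_one_def)

lemma heis_inject: "heis a b c = heis a' b' c' \<longleftrightarrow> a = a' \<and> b = b' \<and> c = c'"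
proof
  assume "heis a b c = heis a' b' c'"
  then have "heis a b c i j = heis a' b' c' i j" for i j by simp
  from this[of 0 1] this[of 1 2] this[of 0 2] show "a = a' \<and> b = b' \<and> c = c'"
    by (simp add: heis_def)
qed simp

text \<open>\<open>B\<close> bounds the entries of the factors, \<open>n\<close> is their number.
  The corner receives at most \<open>B\<close> directly and at most \<open>B * i * B\<close> from
  the product of entries in the step after \<open>i\<close> factors; summed over \<open>n\<close>
  steps this stays below \<open>(B + B ^ 2) * n ^ 2\<close>.\<close>

definition heis_box :: "nat \<Rightarrow> nat \<Rightarrow> (nat \<Rightarrow> nat \<Rightarrow> int) set" where
  "heis_box B n = {heis a b c | a b c. \<bar>a\<bar> \<le> int (B * n) \<and> \<bar>b\<bar> \<le> int (B * n) \<and>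
     \<bar>c\<bar> \<le> int ((B + B ^ 2) * n ^ 2)}"

lemma mem_heis_box: "heis a b c \<in> heis_box B n \<longleftrightarrow>
    \<bar>a\<bar> \<le> int (B * n) \<and> \<bar>b\<bar> \<le> int (B * n) \<and> \<bar>c\<bar> \<le> int ((B + B ^ 2) * n ^ 2)"
  unfolding heis_box_def heis_inject mem_Collect_eq by blast

lemma heis_box_mono:
  assumes "n \<le> m"
  shows "heis_box B n \<subseteq> heis_box B m"
proof
  fix x assume "x \<in> heis_box B n"
  then obtain a b c where x: "x = heis a b c" "heis a b c \<in> heis_box B n"
    unfolding heis_box_def by blast
  have "int (B * n) \<le> int (B * m)" "int ((B + B ^ 2) * n ^ 2) \<le> int ((B + B ^ 2) * m ^ 2)"
    using assms by (simp_all only: of_nat_le_iff mult_le_mono2 power_mono)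
  then show "x \<in> heis_box B m" using x(2) unfolding x(1) mem_heis_box by linarith
qed

lemma heis_box_step:
  assumes "x \<in> heis_box B n" "m = heis a' b' c'" "\<bar>a'\<bar> \<le> int B" "\<bar>b'\<bar> \<le> int B" "\<bar>c'\<bar> \<le> int B"
  shows "x \<otimes>\<^bsub>heisenberg\<^esub> m \<in> heis_box B (Suc n)"
proof -
  obtain a b c where x: "x = heis a b c" "\<bar>a\<bar> \<le> int (B * n)" "\<bar>b\<bar> \<le> int (B * n)"
      "\<bar>c\<bar> \<le> int ((B + B ^ 2) * n ^ 2)"
    using assms(1) by (auto simp: heis_box_def)
  have "\<bar>a * b'\<bar> \<le> int (B * n) * int B"
    using x assms by (auto simp: abs_mult intro!: mult_mono)
  then have "\<bar>c + c' + a * b'\<bar> \<le> int ((B + B ^ 2) * n ^ 2) + int B + int (B * n) * int B"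
    using x assms by linarith
  also have "\<dots> \<le> int ((B + B ^ 2) * Suc n ^ 2)"
    by (simp add: algebra_simps power2_eq_square)
  finally have "\<bar>c + c' + a * b'\<bar> \<le> int ((B + B ^ 2) * Suc n ^ 2)" .
  then show ?thesis unfolding x(1) assms(2) heis_mult mem_heis_box
  proof (intro conjI)
    show "\<bar>a + a'\<bar> \<le> int (B * Suc n)" "\<bar>b + b'\<bar> \<le> int (B * Suc n)"
      using x assms by (auto simp: algebra_simps)
  qed
qed

lemma card_heis_box:
  shows "finite (heis_box B n)" "card (heis_box B n) \<le> (2 * (B + B ^ 2) + 1) ^ 3 * (n + 1) ^ 4"
proof -
  define I where "I = {- int (B * n)..int (B * n)}"
  define J where "J = {- int ((B + B ^ 2) * n ^ 2)..int ((B + B ^ 2) * n ^ 2)}"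
  have sub: "heis_box B n \<subseteq> (\<lambda>(a, b, c). heis a b c) ` (I \<times> I \<times> J)"
  proof
    fix x assume "x \<in> heis_box B n"
    then obtain a b c where x: "x = heis a b c" "heis a b c \<in> heis_box B n"
      unfolding heis_box_def by blast
    then have "(a, b, c) \<in> I \<times> I \<times> J"
      by (simp only: mem_heis_box I_def J_def mem_Times_iff fst_conv snd_conv atLeastAtMost_iff) linarith
    then show "x \<in> (\<lambda>(a, b, c). heis a b c) ` (I \<times> I \<times> J)"
      unfolding x(1) by (rule rev_image_eqI) simp
  qed
  have fin: "finite (I \<times> I \<times> J)" by (simp add: I_def J_def)
  show "finite (heis_box B n)" using sub fin by (meson finite_imageI finite_subset)
  \<comment> \<open>One constant for all three ranges: it dominates the factor of both linear ranges
    and of the quadratic one, hence the cube.\<close>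
  define C where "C = 2 * (B + B ^ 2) + 1"
  have "card (heis_box B n) \<le> card (I \<times> I \<times> J)"
    using surj_card_le[OF fin sub] .
  also have "\<dots> = card I * card I * card J"
    by (simp add: card_cartesian_product)
  also have "\<dots> \<le> (C * (n + 1)) * (C * (n + 1)) * (C * (n + 1) ^ 2)"
  proof (intro mult_le_mono)
    have "card I = 2 * (B * n) + 1" unfolding I_def card_atLeastAtMost_int by linarith
    also have "\<dots> \<le> C * (n + 1)" by (simp add: C_def algebra_simps)
    finally show "card I \<le> C * (n + 1)" "card I \<le> C * (n + 1)" by this+
    have "card J = 2 * ((B + B ^ 2) * n ^ 2) + 1" unfolding J_def card_atLeastAtMost_int by linarith
    also have "\<dots> \<le> C * (n + 1) ^ 2" by (simp add: C_def algebra_simps power2_eq_square)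
    finally show "card J \<le> C * (n + 1) ^ 2" .
  qed
  also have "\<dots> = C ^ 3 * (n + 1) ^ 4"
    by (simp only: power2_eq_square power3_eq_cube power4_eq_xxxx mult_ac)
  finally show "card (heis_box B n) \<le> (2 * (B + B ^ 2) + 1) ^ 3 * (n + 1) ^ 4" by (simp add: C_def)
qed

section \<open>Configurations reachable in linear time\<close>

lemma comp_heis_box:
  assumes B: "\<And>q s q' m. (q', m) \<in> trans A q s \<Longrightarrow>
      \<exists>a b c. m = heis a b c \<and> \<bar>a\<bar> \<le> int B \<and> \<bar>b\<bar> \<le> int B \<and> \<bar>c\<bar> \<le> int B"
  shows "comp heisenberg A q x w q' y n \<Longrightarrow> x \<in> heis_box B l \<Longrightarrow> y \<in> heis_box B (l + n)"
proof (induction arbitrary: l rule: comp.induct)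
  case (comp_read q' m q a x w q'' y n)
  have "x \<otimes>\<^bsub>heisenberg\<^esub> m \<in> heis_box B (Suc l)"
    using B[OF comp_read(1)] heis_box_step[OF comp_read.prems] by blast
  then show ?case using comp_read.IH[of "Suc l"] by simp
next
  case (comp_eps q' m q x w q'' y n)
  have "x \<otimes>\<^bsub>heisenberg\<^esub> m \<in> heis_box B (Suc l)"
    using B[OF comp_eps(1)] heis_box_step[OF comp_eps.prems] by blast
  then show ?case using comp_eps.IH[of "Suc l"] by simp
qed simp

lemma heis_transition_bound:
  assumes "wf_gautomaton heisenberg A"
  shows "\<exists>B. \<forall>q s q' m. (q', m) \<in> trans A q s \<longrightarrow>
    (\<exists>a b c. m = heis a b c \<and> \<bar>a\<bar> \<le> int B \<and> \<bar>b\<bar> \<le> int B \<and> \<bar>c\<bar> \<le> int B)"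
proof -
  \<comment> \<open>The sum of absolute values dominates each entry, so one maximum over the
    finitely many transitions bounds them all.\<close>
  define S where "S = (\<lambda>(q, s, q', m). nat (\<bar>m 0 1\<bar> + \<bar>m 1 2\<bar> + \<bar>m 0 2\<bar>)) ` transitions A"
  have fin: "finite S" unfolding S_def using finite_transitions[OF assms] by (rule finite_imageI)
  have "\<exists>a b c. m = heis a b c \<and> \<bar>a\<bar> \<le> int (Max S) \<and> \<bar>b\<bar> \<le> int (Max S) \<and> \<bar>c\<bar> \<le> int (Max S)"
    if t: "(q', m) \<in> trans A q s" for q s q' m
  proof -
    obtain a b c where m: "m = heis a b c"
      using trans_target_state(2)[OF assms t] unfolding carrier_heisenberg by blast
    have "nat (\<bar>a\<bar> + \<bar>b\<bar> + \<bar>c\<bar>) \<in> S"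
      unfolding S_def transitions_def
      by (rule image_eqI[of _ _ "(q, s, q', m)"]) (simp_all add: m heis_def t[unfolded m heis_def])
    then have "nat (\<bar>a\<bar> + \<bar>b\<bar> + \<bar>c\<bar>) \<le> Max S" using fin by simp
    then show ?thesis using m by (intro exI[of _ a] exI[of _ b] exI[of _ c]) linarith
  qed
  then show ?thesis by blast
qed

lemma bigo_linear_bound:
  assumes "(\<lambda>n. real (t n)) \<in> O(\<lambda>n. real n)"
  shows "\<exists>c::nat. \<forall>n. t n \<le> c * (n + 1)"
proof -
  obtain c N where c: "\<And>n. n \<ge> N \<Longrightarrow> real (t n) \<le> c * real n"
    using assms by (elim landau_o.bigE) (auto simp: eventually_sequentially)
  \<comment> \<open>The ceiling serves large \<open>n\<close>, the maximum the finitely many small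
    ones. The bound is a multiple of \<open>n + 1\<close> because \<open>t 0\<close> may be
    positive.\<close>
  define d where "d = nat \<lceil>c\<rceil> + Max (t ` {..N})"
  have "t n \<le> d * (n + 1)" for n
  proof (cases "n \<ge> N")
    case True
    have "c * real n \<le> real (nat \<lceil>c\<rceil>) * real n"
      by (intro mult_right_mono) (simp_all add: real_nat_ceiling_ge)
    then have "real (t n) \<le> real (nat \<lceil>c\<rceil> * n)" using c[OF True] by simp
    then have "t n \<le> nat \<lceil>c\<rceil> * n" by (simp only: of_nat_le_iff)
    also have "\<dots> \<le> d * (n + 1)" by (intro mult_le_mono) (simp_all add: d_def)
    finally show ?thesis .
  next
    case False
    then have "t n \<le> Max (t ` {..N})" by (intro Max_ge) auto
    also have "\<dots> \<le> d * 1" by (simp only: d_def mult_1_right le_add2)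
    also have "\<dots> \<le> d * (n + 1)" by (intro mult_le_mono2) simp
    finally show ?thesis .
  qed
  then show ?thesis by blast
qed
text \<open>Prefixes that lead to the same configuration can be exchanged, and in linear time only
  quartically many configurations are reachable.\<close>

lemma heis_fooling_bound:
  fixes L :: "'a list set"
  assumes "L \<in> lin_time_class heisenberg"
  shows "\<exists>C. \<forall>n (I :: 'i set) u v. (\<forall>i\<in>I. u i @ v i \<in> L \<and> length (u i @ v i) \<le> n) \<and>
    (\<forall>i\<in>I. \<forall>j\<in>I. u i @ v j \<in> L \<longrightarrow> i = j) \<longrightarrow> card I \<le> C * (n + 1) ^ 4"
proof -
  obtain A t where A: "wf_gautomaton heisenberg A" "recognizes heisenberg A L"
      "weakly_time_bounded heisenberg A L t" "(\<lambda>n. real (t n)) \<in> O(\<lambda>n. real n)"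
    using assms unfolding lin_time_class_def by blast
  obtain c where c: "\<And>n. t n \<le> c * (n + 1)" using bigo_linear_bound[OF A(4)] by blast
  obtain B where B: "\<And>q s q' m. (q', m) \<in> trans A q s \<Longrightarrow>
      \<exists>a b c. m = heis a b c \<and> \<bar>a\<bar> \<le> int B \<and> \<bar>b\<bar> \<le> int B \<and> \<bar>c\<bar> \<le> int B"
    using heis_transition_bound[OF A(1)] by blast
  have fin: "finite (states A)" and init: "init A \<in> states A"
    using A(1) by (simp_all add: wf_gautomaton_def)
  \<comment> \<open>The factor \<open>(c + 1) ^ 4\<close> comes from
    \<open>c * (n + 1) + 1 \<le> (c + 1) * (n + 1)\<close>.\<close>
  define C where "C = card (states A) * ((2 * (B + B ^ 2) + 1) ^ 3 * (c + 1) ^ 4)"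
  have "card I \<le> C * (n + 1) ^ 4"
    if uv: "\<forall>i\<in>I. u i @ v i \<in> L \<and> length (u i @ v i) \<le> n"
      "\<forall>i\<in>I. \<forall>j\<in>I. u i @ v j \<in> L \<longrightarrow> i = j" for n and I :: "'i set" and u v
  proof -
    \<comment> \<open>The prefix \<open>u i\<close> is read during a fast accepting run of
      \<open>u i @ v i\<close>, so the configuration reached after it lies in
      \<open>K\<close>.\<close>
    define K where "K = states A \<times> heis_box B (c * (n + 1))"
    have "\<exists>\<kappa>. \<kappa> \<in> K \<and> (\<exists>k. comp heisenberg A (init A) \<one>\<^bsub>heisenberg\<^esub> (u i) (fst \<kappa>) (snd \<kappa>) k) \<and>
        (\<exists>q l. q \<in> accepting A \<and> comp heisenberg A (fst \<kappa>) (snd \<kappa>) (v i) q \<one>\<^bsub>heisenberg\<^esub> l)"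
      if i: "i \<in> I" for i
    proof -
      obtain s q where s: "s \<le> t (length (u i @ v i))" "q \<in> accepting A"
          "comp heisenberg A (init A) \<one>\<^bsub>heisenberg\<^esub> (u i @ v i) q \<one>\<^bsub>heisenberg\<^esub> s"
        using A(3) uv(1) i unfolding weakly_time_bounded_def accepts_in_def by blast
      obtain p y k l where p: "comp heisenberg A (init A) \<one>\<^bsub>heisenberg\<^esub> (u i) p y k"
          "comp heisenberg A p y (v i) q \<one>\<^bsub>heisenberg\<^esub> l" "s = k + l"
        using comp_split[OF s(3)] by blast
      have "k \<le> t (length (u i @ v i))" using s(1) p(3) by simp
      also have "\<dots> \<le> c * (length (u i @ v i) + 1)" by (rule c)
      also have "\<dots> \<le> c * (n + 1)" using uv(1) i by (intro mult_le_mono2) auto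
      finally have k: "k \<le> c * (n + 1)" .
      have "\<one>\<^bsub>heisenberg\<^esub> \<in> heis_box B 0" unfolding heis_one mem_heis_box by simp
      then have "y \<in> heis_box B (0 + k)" using comp_heis_box[of A B, OF _ p(1)] B by blast
      then have "y \<in> heis_box B (c * (n + 1))" using heis_box_mono[OF k] by auto
      moreover have "p \<in> states A" using comp_states[OF A(1) p(1) init] .
      ultimately have "(p, y) \<in> K" by (simp add: K_def)
      then show ?thesis using p s(2) by (intro exI[of _ "(p, y)"]) auto
    qed
    then obtain \<kappa> where \<kappa>: "\<And>i. i \<in> I \<Longrightarrow> \<kappa> i \<in> K"
        "\<And>i. i \<in> I \<Longrightarrow> \<exists>k. comp heisenberg A (init A) \<one>\<^bsub>heisenberg\<^esub> (u i) (fst (\<kappa> i)) (snd (\<kappa> i)) k"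
        "\<And>i. i \<in> I \<Longrightarrow> \<exists>q l. q \<in> accepting A \<and>
            comp heisenberg A (fst (\<kappa> i)) (snd (\<kappa> i)) (v i) q \<one>\<^bsub>heisenberg\<^esub> l"
      by metis
    \<comment> \<open>A shared configuration lets \<open>u i\<close> be continued by
      \<open>v j\<close>. The spliced run may have any length, since acceptance does not count
      steps.\<close>
    have "inj_on \<kappa> I"
    proof (rule inj_onI)
      fix i j assume ij: "i \<in> I" "j \<in> I" "\<kappa> i = \<kappa> j"
      obtain k where k: "comp heisenberg A (init A) \<one>\<^bsub>heisenberg\<^esub> (u i) (fst (\<kappa> j)) (snd (\<kappa> j)) k"
        using \<kappa>(2)[OF ij(1)] ij(3) by auto
      obtain q l where q: "q \<in> accepting A"
          "comp heisenberg A (fst (\<kappa> j)) (snd (\<kappa> j)) (v j) q \<one>\<^bsub>heisenberg\<^esub> l"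
        using \<kappa>(3)[OF ij(2)] by blast
      have run: "comp heisenberg A (init A) \<one>\<^bsub>heisenberg\<^esub> (u i @ v j) q \<one>\<^bsub>heisenberg\<^esub> (k + l)"
        using k q(2) by (rule comp_append)
      then have "accepts heisenberg A (u i @ v j)"
        using q(1) unfolding accepts_def accepts_in_def by blast
      then have "u i @ v j \<in> L"
        using A(2) comp_lists_alphabet[OF A(1) run] unfolding recognizes_def by blast
      then show "i = j" using uv(2) ij(1,2) by blast
    qed
    moreover have "\<kappa> ` I \<subseteq> K" using \<kappa>(1) by blast
    moreover have "finite K" unfolding K_def using fin card_heis_box(1) by blast
    ultimately have "card I \<le> card K" by (rule card_inj_on_le)
    also have "\<dots> = card (states A) * card (heis_box B (c * (n + 1)))"
      by (simp add: K_def card_cartesian_product)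
    also have "\<dots> \<le> card (states A) * ((2 * (B + B ^ 2) + 1) ^ 3 * (c * (n + 1) + 1) ^ 4)"
      by (intro mult_le_mono2 card_heis_box)
    also have "\<dots> \<le> card (states A) * ((2 * (B + B ^ 2) + 1) ^ 3 * ((c + 1) * (n + 1)) ^ 4)"
      by (intro mult_le_mono2 power_mono) simp_all
    also have "\<dots> = C * (n + 1) ^ 4" by (simp only: C_def power_mult_distrib mult.assoc)
    finally show ?thesis .
  qed
  then show ?thesis by blast
qed

section \<open>Sorted words with trivial product\<close>

text \<open>Common form of both separating languages: sortedness fixes the order of the factors, so
  a trivial product becomes a system of equations between letter counts.\<close>

definition sorted_words :: "('g, 'b) monoid_scheme \<Rightarrow> (nat \<Rightarrow> 'g) \<Rightarrow> nat \<Rightarrow> nat list set" where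
  "sorted_words G g r =
    {w \<in> lists {..<r}. sorted w \<and> foldl (\<otimes>\<^bsub>G\<^esub>) \<one>\<^bsub>G\<^esub> (map g w) = \<one>\<^bsub>G\<^esub>}"

text \<open>The state is the last letter read, which enforces sortedness; every state accepts, so
  the register alone decides. Without epsilon transitions a run takes exactly one step per
  letter.\<close>

definition sorted_automaton :: "(nat \<Rightarrow> 'g) \<Rightarrow> nat \<Rightarrow> (nat, 'g) gautomaton" where
  "sorted_automaton g r = \<lparr>states = {..<r}, alphabet = {..<r},
    trans = (\<lambda>q s. case s of None \<Rightarrow> {} | Some a \<Rightarrow> if q \<le> a \<and> a < r then {(a, g a)} else {}),
    init = 0, accepting = {..<r}\<rparr>"

lemma sorted_automaton_comp_imp:
  "comp G (sorted_automaton g r) q x w q' y n \<Longrightarrow>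
    w \<in> lists {..<r} \<and> sorted (q # w) \<and> y = foldl (\<otimes>\<^bsub>G\<^esub>) x (map g w)"
  by (induction rule: comp.induct) (auto simp: sorted_automaton_def split: if_splits)

lemma sorted_automaton_comp:
  "w \<in> lists {..<r} \<Longrightarrow> sorted (q # w) \<Longrightarrow>
    comp G (sorted_automaton g r) q x w (last (q # w)) (foldl (\<otimes>\<^bsub>G\<^esub>) x (map g w)) (length w)"
proof (induction w arbitrary: q x)
  case Nil
  then show ?case by (simp add: comp_nil)
next
  case (Cons a w)
  have "comp G (sorted_automaton g r) a (x \<otimes>\<^bsub>G\<^esub> g a) w (last (a # w))
      (foldl (\<otimes>\<^bsub>G\<^esub>) (x \<otimes>\<^bsub>G\<^esub> g a) (map g w)) (length w)"
    using Cons.prems by (intro Cons.IH) auto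
  moreover have "(a, g a) \<in> trans (sorted_automaton g r) q (Some a)"
    using Cons.prems by (simp add: sorted_automaton_def)
  ultimately show ?case by (auto intro: comp_read)
qed

lemma sorted_words_lin_time:
  assumes "r > 0" "\<And>i. i < r \<Longrightarrow> g i \<in> carrier G"
  shows "sorted_words G g r \<in> lin_time_class G"
proof -
  let ?A = "sorted_automaton g r"
  have acc: "accepts_in G ?A w (length w)" if "w \<in> sorted_words G g r" for w
  proof -
    have w: "w \<in> lists {..<r}" "sorted (0 # w)" "foldl (\<otimes>\<^bsub>G\<^esub>) \<one>\<^bsub>G\<^esub> (map g w) = \<one>\<^bsub>G\<^esub>"
      using that by (auto simp: sorted_words_def)
    have "last (0 # w) < r" using w(1) assms(1) last_in_set[of w] by auto
    then show ?thesis using sorted_automaton_comp[OF w(1,2), of G g "\<one>\<^bsub>G\<^esub>"] w(3)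
      by (auto simp: accepts_in_def sorted_automaton_def)
  qed
  have "wf_gautomaton G ?A"
    using assms by (auto simp: wf_gautomaton_def sorted_automaton_def split: option.split)
  moreover have "recognizes G ?A (sorted_words G g r)"
    unfolding recognizes_def
  proof (intro equalityI subsetI)
    fix w assume w: "w \<in> sorted_words G g r"
    then have "w \<in> lists (alphabet ?A)" by (simp add: sorted_words_def sorted_automaton_def)
    then show "w \<in> {w \<in> lists (alphabet ?A). accepts G ?A w}"
      using acc[OF w] by (auto simp: accepts_def)
  next
    fix w assume "w \<in> {w \<in> lists (alphabet ?A). accepts G ?A w}"
    then show "w \<in> sorted_words G g r"
      unfolding accepts_def accepts_in_def sorted_words_def
      by (fastforce dest: sorted_automaton_comp_imp)
  qed
  moreover have "weakly_time_bounded G ?A (sorted_words G g r) (\<lambda>n. n)"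
    using acc by (auto simp: weakly_time_bounded_def)
  moreover have "(\<lambda>n. real n) \<in> O(\<lambda>n. real n)" by simp
  ultimately show ?thesis unfolding lin_time_class_def by blast
qed

section \<open>Sorted words described by their block lengths\<close>

definition blocks :: "(nat \<Rightarrow> nat) \<Rightarrow> nat list \<Rightarrow> nat list" where
  "blocks f xs = concat (map (\<lambda>i. replicate (f i) i) xs)"

lemma blocks_append [simp]: "blocks f (xs @ ys) = blocks f xs @ blocks f ys"
  by (simp add: blocks_def)

lemma blocks_lists: "blocks f [0..<r] \<in> lists {..<r}"
  by (auto simp: blocks_def)

lemma sorted_blocks: "sorted (blocks f [0..<r])"
proof (induction r)
  case (Suc r)
  then show ?case using blocks_lists[of f r] by (auto simp: sorted_append blocks_def)
qed (simp add: blocks_def)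

lemma count_blocks: "count_list (blocks f [0..<r]) i = (if i < r then f i else 0)"
proof -
  have "count_list (replicate n j) i = (if i = j then n else 0)" for n j
    by (induction n) auto
  then show ?thesis by (induction r) (auto simp: blocks_def)
qed

lemma length_blocks: "length (blocks f [m..<r]) = (\<Sum>i=m..<r. f i)"
  by (simp add: blocks_def length_concat o_def interv_sum_list_conv_sum_set_nat)

text \<open>A sorted word is determined by its multiset of letters.\<close>

lemma sorted_eq_blocks:
  assumes "sorted w" "w \<in> lists {..<r}"
  shows "w = blocks (count_list w) [0..<r]"
proof -
  have "mset (blocks (count_list w) [0..<r]) = mset w"
    using assms(2) by (intro multiset_eqI) (auto simp: count_mset count_blocks)
  then have "sort w = blocks (count_list w) [0..<r]"
    using sorted_blocks by (rule properties_for_sort)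
  then show ?thesis using assms(1) by (simp add: sorted_sort_id)
qed

section \<open>A Heisenberg language with quadratically growing word lengths\<close>

text \<open>Letter 2 lowers the first entry \<open>p\<close> by 2 and adds \<open>1 - p\<close> to
  the corner. Over \<open>n\<close> repetitions this contributes
  \<open>n - n * p + n * (n - 1)\<close>: the step width 2 doubles the triangular number and the 1
  completes it to \<open>n ^ 2\<close>.\<close>

definition heis_letter :: "nat \<Rightarrow> nat \<Rightarrow> nat \<Rightarrow> int" where
  "heis_letter i = [heis 2 0 0, heis 0 1 0, heis (-2) (-1) 1, heis 0 0 (-1)] ! i"

lemma foldl_heis_replicate:
  "foldl (\<otimes>\<^bsub>heisenberg\<^esub>) (heis p q s) (replicate n (heis 2 0 0)) = heis (p + 2 * int n) q s"
  "foldl (\<otimes>\<^bsub>heisenberg\<^esub>) (heis p q s) (replicate n (heis 0 1 0)) = heis p (q + int n) (s + int n * p)"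
  "foldl (\<otimes>\<^bsub>heisenberg\<^esub>) (heis p q s) (replicate n (heis (-2) (-1) 1)) =
    heis (p - 2 * int n) (q - int n) (s - int n * p + int n ^ 2)"
  "foldl (\<otimes>\<^bsub>heisenberg\<^esub>) (heis p q s) (replicate n (heis 0 0 (-1))) = heis p q (s - int n)"
  by (induction n arbitrary: p q s)
    (simp_all add: heis_mult, simp_all add: heis_inject algebra_simps power2_eq_square)

lemma heis_letter_simps:
  "heis_letter 0 = heis 2 0 0" "heis_letter 1 = heis 0 1 0"
  "heis_letter 2 = heis (-2) (-1) 1" "heis_letter 3 = heis 0 0 (-1)"
  by (simp_all add: heis_letter_def numeral_eq_Suc del: One_nat_def)

lemma upt_4: "[0..<4] = [0, 1, 2, 3]"
  by (simp add: upt_rec)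

text \<open>The two linear entries force \<open>f 0 = f 2\<close> and \<open>f 1 = f 2\<close>. The
  mixed terms of the corner then cancel, and \<open>f 2 ^ 2 - f 3\<close> remains.\<close>

lemma heis_blocks_product:
  "foldl (\<otimes>\<^bsub>heisenberg\<^esub>) \<one>\<^bsub>heisenberg\<^esub> (map heis_letter (blocks f [0..<4])) = \<one>\<^bsub>heisenberg\<^esub> \<longleftrightarrow>
    f 0 = f 2 \<and> f 1 = f 2 \<and> f 3 = f 2 ^ 2"
proof -
  let ?p = "2 * int (f 0) - 2 * int (f 2)" and ?q = "int (f 1) - int (f 2)"
  let ?s = "2 * int (f 0) * int (f 1) - 2 * int (f 0) * int (f 2) + int (f 2) ^ 2 - int (f 3)"
  have b: "blocks f [0..<4] = replicate (f 0) 0 @ replicate (f 1) 1 @ replicate (f 2) 2 @ replicate (f 3) 3"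
    unfolding upt_4 blocks_def by simp
  have "foldl (\<otimes>\<^bsub>heisenberg\<^esub>) \<one>\<^bsub>heisenberg\<^esub> (map heis_letter (blocks f [0..<4])) = heis ?p ?q ?s"
    unfolding b heis_one map_append map_replicate foldl_append heis_letter_simps foldl_heis_replicate
    by (simp only: heis_inject) (simp add: algebra_simps)
  moreover have "?p = 0 \<and> ?q = 0 \<and> ?s = 0 \<longleftrightarrow> f 0 = f 2 \<and> f 1 = f 2 \<and> int (f 3) = int (f 2 ^ 2)"
    by (auto simp: algebra_simps)
  ultimately show ?thesis by (simp only: heis_one heis_inject of_nat_eq_iff)
qed

abbreviation "heis_words \<equiv> sorted_words heisenberg heis_letter 4"

lemma heis_words_lin_time: "heis_words \<in> lin_time_class heisenberg"
proof (rule sorted_words_lin_time)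
  show "heis_letter i \<in> carrier heisenberg" if "i < 4" for i
    using that by (auto simp: heis_letter_def heis_carrier less_Suc_eq numeral_eq_Suc)
qed simp

lemma heis_words_lengths: "length ` heis_words = range (\<lambda>n. n ^ 2 + 3 * n)"
proof -
  have len: "length (blocks f [0..<4]) = f 0 + f 1 + f 2 + f 3" for f
    unfolding blocks_def upt_4 by simp
  show ?thesis
  proof (intro equalityI subsetI)
    fix l assume "l \<in> length ` heis_words"
    then obtain w where w: "l = length w" "w \<in> lists {..<4}" "sorted w"
        "foldl (\<otimes>\<^bsub>heisenberg\<^esub>) \<one>\<^bsub>heisenberg\<^esub> (map heis_letter w) = \<one>\<^bsub>heisenberg\<^esub>"
      by (auto simp: sorted_words_def)
    define f where "f = count_list w"
    have b: "w = blocks f [0..<4]" using w(2,3) unfolding f_def by (intro sorted_eq_blocks)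
    have "f 0 = f 2 \<and> f 1 = f 2 \<and> f 3 = f 2 ^ 2"
      using w(4) unfolding b heis_blocks_product .
    then have "l = f 2 ^ 2 + 3 * f 2" unfolding w(1) b len by simp
    then show "l \<in> range (\<lambda>n. n ^ 2 + 3 * n)" by blast
  next
    fix l assume "l \<in> range (\<lambda>n::nat. n ^ 2 + 3 * n)"
    then obtain n where l: "l = n ^ 2 + 3 * n" by blast
    define f where "f = (\<lambda>i::nat. if i = 3 then n ^ 2 else n)"
    have "blocks f [0..<4] \<in> heis_words"
      using blocks_lists[of f 4] sorted_blocks[of f 4] heis_blocks_product[of f]
      by (simp add: sorted_words_def f_def)
    moreover have "length (blocks f [0..<4]) = l" unfolding len l by (simp add: f_def)
    ultimately show "l \<in> length ` heis_words" by blast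
  qed
qed

lemma infinite_heis_words_lengths: "infinite (length ` heis_words)"
proof -
  have "strict_mono (\<lambda>n::nat. n ^ 2 + 3 * n)"
    by (rule strict_monoI) (simp add: add_less_le_mono power_strict_mono add_strict_mono)
  then show ?thesis
    unfolding heis_words_lengths by (intro range_inj_infinite strict_mono_imp_inj_on)
qed

text \<open>The gap after the \<open>i\<close>-th length is \<open>2 * i + 4\<close>, which outgrows
  any fixed difference \<open>d\<close>.\<close>

lemma heis_words_lengths_no_progression: "\<not> has_progression (length ` heis_words)"
proof
  define p where "p = (\<lambda>n::nat. n ^ 2 + 3 * n)"
  have mono: "p i \<le> p j" if "i \<le> j" for i j
    using that by (simp add: p_def add_mono power_mono)
  assume "has_progression (length ` heis_words)"
  then obtain b d where d: "d > 0" "\<And>m. b + m * d \<in> range p"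
    unfolding heis_words_lengths has_progression_def p_def by blast
  \<comment> \<open>Far enough out that the term equals \<open>p i\<close> with
    \<open>i > d\<close>; the next term would then have to fall into a gap wider than
    \<open>d\<close>.\<close>
  define m where "m = Suc (p d)"
  obtain i where i: "b + m * d = p i" using d(2) by blast
  obtain j where j: "b + Suc m * d = p j" using d(2) by blast
  have "p d < m * 1" by (simp add: m_def)
  also have "\<dots> \<le> m * d" using d(1) by (intro mult_le_mono2) simp
  finally have "p d < p i" using i by simp
  then have "d < i" using mono[of i d] by linarith
  moreover have "p i < p j" using i j d(1) by simp
  then have "Suc i \<le> j" using mono[of j i] by linarith
  then have "p (Suc i) \<le> p j" by (rule mono)
  then have "p i + 2 * i + 4 \<le> p j" by (simp add: p_def power2_eq_square)
  then have "2 * i + 4 \<le> d" using i j by simp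
  ultimately show False by simp
qed

section \<open>A free Abelian language with many prefixes\<close>

text \<open>Letters 0 to 4 are the first five unit vectors and letters 5 to 9 their negatives. The
  condition \<open>j < 5\<close> keeps the latter from raising a coordinate of their own;
  coordinates from 5 on stay 0, so one definition serves every \<open>k \<ge> 5\<close>.\<close>

definition Zk_letter :: "nat \<Rightarrow> nat \<Rightarrow> int" where
  "Zk_letter i = (\<lambda>j. (if i = j \<and> j < 5 then 1 else 0) - (if i = j + 5 then 1 else 0))"

abbreviation "Zk_words k \<equiv> sorted_words (Zk k) Zk_letter 10"

lemma Zk_words_lin_time:
  assumes "k \<ge> 5"
  shows "Zk_words k \<in> lin_time_class (Zk k)"
  by (rule sorted_words_lin_time) (use assms in \<open>auto simp: Zk_def Zk_letter_def\<close>)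

lemma foldl_Zk: "foldl (\<otimes>\<^bsub>Zk k\<^esub>) x (map g w) j = x j + (\<Sum>a\<leftarrow>w. g a j)"
  by (induction w arbitrary: x) (auto simp: Zk_def)

lemma sum_blocks: "(\<Sum>a\<leftarrow>blocks f [0..<r]. \<phi> a) = (\<Sum>i<r. int (f i) * \<phi> i)"
proof (induction r)
  case (Suc r)
  have "(\<Sum>a\<leftarrow>blocks f [r]. \<phi> a) = int (f r) * \<phi> r"
    by (simp add: blocks_def sum_list_replicate)
  then show ?case using Suc by simp
qed (simp add: blocks_def)

lemma Zk_blocks_product:
  "foldl (\<otimes>\<^bsub>Zk k\<^esub>) \<one>\<^bsub>Zk k\<^esub> (map Zk_letter (blocks f [0..<10])) = \<one>\<^bsub>Zk k\<^esub> \<longleftrightarrow>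
    (\<forall>j<5. f j = f (j + 5))"
proof -
  have "foldl (\<otimes>\<^bsub>Zk k\<^esub>) \<one>\<^bsub>Zk k\<^esub> (map Zk_letter (blocks f [0..<10])) j =
      (if j < 5 then int (f j) - int (f (j + 5)) else 0)" for j
  proof -
    have "(\<Sum>i<10. int (f i) * Zk_letter i j) =
        (\<Sum>i<10. if i = j then (if j < 5 then int (f i) else 0) else 0) -
        (\<Sum>i<10. if i = j + 5 then int (f i) else 0)"
      unfolding sum_subtractf[symmetric] by (intro sum.cong) (auto simp: Zk_letter_def)
    also have "\<dots> = (if j < 5 then int (f j) - int (f (j + 5)) else 0)"
      by (simp add: sum.delta)
    finally show ?thesis unfolding foldl_Zk sum_blocks by (simp add: Zk_def)
  qed
  then show ?thesis by (auto simp: fun_eq_iff Zk_def)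
qed

text \<open>The 10 is the number of blocks, each of length at most \<open>n\<close>. Choosing
  \<open>n = C * 10 ^ 4\<close> turns the left side into \<open>n * (n + 1) ^ 4\<close>.\<close>

lemma quintic_exceeds_quartic: "\<exists>n::nat. C * (10 * (n + 1)) ^ 4 < (n + 1) ^ 5"
proof -
  define n where "n = C * 10 ^ 4"
  have "C * (10 * (n + 1)) ^ 4 = n * (n + 1) ^ 4" by (simp only: n_def power_mult_distrib mult.assoc)
  also have "\<dots> < (n + 1) * (n + 1) ^ 4" by simp
  also have "\<dots> = (n + 1) ^ 5" by (simp add: numeral_eq_Suc)
  finally show ?thesis by blast
qed

lemma Zk_words_not_heis: "Zk_words k \<notin> lin_time_class heisenberg"
proof
  assume "Zk_words k \<in> lin_time_class heisenberg"
  then obtain C where C: "\<And>n (I :: (nat \<Rightarrow> nat) set) u v.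
      (\<forall>i\<in>I. u i @ v i \<in> Zk_words k \<and> length (u i @ v i) \<le> n) \<and>
      (\<forall>i\<in>I. \<forall>j\<in>I. u i @ v j \<in> Zk_words k \<longrightarrow> i = j) \<Longrightarrow> card I \<le> C * (n + 1) ^ 4"
    using heis_fooling_bound by blast
  define u where "u = (\<lambda>f. blocks f [0..<5])"
  \<comment> \<open>Shifting by 5 lets the same five exponents serve as prefix and as matching
    suffix.\<close>
  define v where "v = (\<lambda>f::nat \<Rightarrow> nat. blocks (\<lambda>i. f (i - 5)) [5..<10])"
  have uv: "u f @ v g = blocks (\<lambda>i. if i < 5 then f i else g (i - 5)) [0..<10]" for f g
    by (simp add: u_def v_def blocks_def upt_rec numeral_eq_Suc)
  have mem: "u f @ v g \<in> Zk_words k \<longleftrightarrow> (\<forall>j<5. f j = g j)" for f g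
    unfolding uv sorted_words_def mem_Collect_eq Zk_blocks_product
    using blocks_lists sorted_blocks by simp
  have bound: "(n + 1) ^ 5 \<le> C * (10 * n + 1) ^ 4" for n
  proof -
    \<comment> \<open>Extensional functions are determined by their five values, so that equal
      exponents mean equal indices and the cardinality is a plain power.\<close>
    define I where "I = PiE {..<5::nat} (\<lambda>_. {..n})"
    have "card I = (n + 1) ^ 5" by (simp add: I_def card_PiE)
    moreover have "card I \<le> C * (10 * n + 1) ^ 4"
    proof (rule C[of I u v], intro conjI ballI impI)
      fix f assume f: "f \<in> I"
      show "u f @ v f \<in> Zk_words k" by (simp add: mem)
      have "length (u f @ v f) \<le> (\<Sum>i=0..<10::nat. n)"
        unfolding uv length_blocks using f by (intro sum_mono) (auto simp: I_def PiE_iff)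
      then show "length (u f @ v f) \<le> 10 * n" by simp
    next
      fix f g assume "f \<in> I" "g \<in> I" "u f @ v g \<in> Zk_words k"
      then show "f = g" unfolding mem I_def by (intro PiE_ext) auto
    qed
    ultimately show ?thesis by simp
  qed
  obtain n where n: "C * (10 * (n + 1)) ^ 4 < (n + 1) ^ 5" using quintic_exceeds_quartic by blast
  have "C * (10 * n + 1) ^ 4 \<le> C * (10 * (n + 1)) ^ 4" by (intro mult_le_mono2 power_mono) simp_all
  then show False using bound[of n] n by linarith
qed

section \<open>A context-free language with many prefixes\<close>

definition marked_palindrome_grammar :: "(nat \<times> (nat + nat) list) set" where
  "marked_palindrome_grammar =
    {(0, [Inr 0, Inl 0, Inr 0]), (0, [Inr 1, Inl 0, Inr 1]), (0, [Inr 2])}"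

abbreviation "marked_palindromes \<equiv> cfg_lang marked_palindrome_grammar 0"

lemma marked_palindromes_CF: "marked_palindromes \<in> CF"
proof -
  have "finite marked_palindrome_grammar" by (simp add: marked_palindrome_grammar_def)
  then show ?thesis unfolding CF_def by blast
qed

text \<open>A form with a single nonterminal can be rewritten only at that place, which makes the
  derivations of the palindrome grammar easy to trace.\<close>

lemma terminals_nonterminal_unique:
  "map Inr u @ Inl A # map Inr v = x @ Inl B # y \<Longrightarrow> A = B \<and> x = map Inr u \<and> y = map Inr v"
proof (induction u arbitrary: x)
  case Nil
  then show ?case by (cases x) (auto simp: map_eq_append_conv)
next
  case (Cons a u)
  then show ?case by (cases x) auto
qed

lemma map_Inr_no_Inl: "map Inr u \<noteq> x @ Inl B # y"
  by (auto simp: map_eq_append_conv)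

lemma marked_palindrome_derivation:
  assumes "(cfg_step marked_palindrome_grammar)\<^sup>*\<^sup>* [Inl 0] \<alpha>"
  shows "\<exists>u\<in>lists {0, 1}. \<alpha> = map Inr u @ Inl 0 # map Inr (rev u) \<or> \<alpha> = map Inr (u @ 2 # rev u)"
  using assms
proof (induction rule: rtranclp_induct)
  case base
  show ?case by (intro bexI[of _ "[]"]) auto
next
  case (step \<alpha> \<beta>)
  obtain A rhs x y where s: "(A, rhs) \<in> marked_palindrome_grammar" "\<alpha> = x @ Inl A # y" "\<beta> = x @ rhs @ y"
    using step(2) by (auto elim: cfg_step.cases)
  obtain u where u: "u \<in> lists {0, 1}" "\<alpha> = map Inr u @ Inl 0 # map Inr (rev u)"
    using step.IH map_Inr_no_Inl[of _ x A y] unfolding s(2) by metis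
  have xy: "x = map Inr u" "y = map Inr (rev u)"
    using terminals_nonterminal_unique[of u 0 "rev u" x A y] u(2) s(2) by auto
  consider c where "c \<in> {0, 1}" "rhs = [Inr c, Inl 0, Inr c]" | "rhs = [Inr 2]"
    using s(1) unfolding marked_palindrome_grammar_def by auto
  then show ?case
  proof cases
    case 1
    then show ?thesis using u(1) unfolding s(3) xy by (intro bexI[of _ "u @ [c]"]) auto
  next
    case 2
    then show ?thesis using u(1) unfolding s(3) xy by (intro bexI[of _ u]) auto
  qed
qed

lemma mem_marked_palindromes:
  "w \<in> marked_palindromes \<longleftrightarrow> (\<exists>u\<in>lists {0, 1}. w = u @ 2 # rev u)"
proof
  assume "w \<in> marked_palindromes"
  then have "(cfg_step marked_palindrome_grammar)\<^sup>*\<^sup>* [Inl 0] (map Inr w)"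
    by (simp add: cfg_lang_def)
  from marked_palindrome_derivation[OF this] show "\<exists>u\<in>lists {0, 1}. w = u @ 2 # rev u"
  proof (elim bexE disjE)
    fix u :: "nat list"
    assume "map Inr w = map Inr u @ Inl (0::nat) # map Inr (rev u)"
    with map_Inr_no_Inl show ?thesis by (rule notE)
  next
    fix u :: "nat list"
    assume u: "u \<in> lists {0, 1}" "(map Inr w :: (nat + nat) list) = map Inr (u @ 2 # rev u)"
    have "w = u @ 2 # rev u" using u(2) by (simp only: inj_map_eq_map[OF inj_Inr])
    with u(1) show ?thesis by (rule rev_bexI)
  qed
next
  assume "\<exists>u\<in>lists {0, 1}. w = u @ 2 # rev u"
  then obtain u where u: "u \<in> lists {0, 1}" "w = u @ 2 # rev u" by blast
  have step: "cfg_step marked_palindrome_grammar (map Inr u @ [Inl 0] @ map Inr (rev u))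
      (map Inr u @ rhs @ map Inr (rev u))" if "(0, rhs) \<in> marked_palindrome_grammar" for rhs u
    using that by (rule cfg_step.intros)
  have "(cfg_step marked_palindrome_grammar)\<^sup>*\<^sup>* [Inl 0] (map Inr u @ [Inl 0] @ map Inr (rev u))"
    using u(1)
  proof (induction u rule: rev_induct)
    case (snoc c u)
    have "(0, [Inr c, Inl 0, Inr c]) \<in> marked_palindrome_grammar"
      using snoc.prems by (auto simp: marked_palindrome_grammar_def)
    from step[OF this, of u] have "cfg_step marked_palindrome_grammar
        (map Inr u @ [Inl 0] @ map Inr (rev u)) (map Inr (u @ [c]) @ [Inl 0] @ map Inr (rev (u @ [c])))"
      by simp
    moreover have "(cfg_step marked_palindrome_grammar)\<^sup>*\<^sup>* [Inl 0] (map Inr u @ [Inl 0] @ map Inr (rev u))"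
      using snoc by auto
    ultimately show ?case by (metis rtranclp.rtrancl_into_rtrancl)
  qed simp
  moreover have "cfg_step marked_palindrome_grammar (map Inr u @ [Inl 0] @ map Inr (rev u)) (map Inr w)"
    using step[of "[Inr 2]" u] by (simp add: u(2) marked_palindrome_grammar_def)
  ultimately have "(cfg_step marked_palindrome_grammar)\<^sup>*\<^sup>* [Inl 0] (map Inr w)"
    by (rule rtranclp.rtrancl_into_rtrancl)
  then show "w \<in> marked_palindromes" by (simp add: cfg_lang_def)
qed

text \<open>With \<open>n = 5 * m\<close> the quintic comparison applies, because
  \<open>m + 1 \<le> 2 ^ m\<close>. The base \<open>2 * n + 2\<close> is the word length
  \<open>2 * n + 1\<close> plus the 1 of the fooling bound.\<close>

lemma exponential_exceeds_quartic: "\<exists>n::nat. C * (2 * n + 2) ^ 4 < (2::nat) ^ n"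
proof -
  obtain m where m: "C * (10 * (m + 1)) ^ 4 < (m + 1) ^ 5" using quintic_exceeds_quartic by blast
  have "C * (2 * (5 * m) + 2) ^ 4 \<le> C * (10 * (m + 1)) ^ 4"
    by (intro mult_le_mono2 power_mono) simp_all
  also have "\<dots> < (m + 1) ^ 5" by (fact m)
  also have "\<dots> \<le> (2 ^ m) ^ 5"
    using less_exp[of m] by (intro power_mono) (simp_all add: Suc_le_eq)
  also have "\<dots> = 2 ^ (5 * m)" by (simp add: mult.commute flip: power_mult)
  finally show ?thesis by blast
qed

lemma marked_palindromes_not_heis: "marked_palindromes \<notin> lin_time_class heisenberg"
proof
  assume "marked_palindromes \<in> lin_time_class heisenberg"
  then obtain C where C: "\<And>n (I :: nat list set) u v.
      (\<forall>i\<in>I. u i @ v i \<in> marked_palindromes \<and> length (u i @ v i) \<le> n) \<and>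
      (\<forall>i\<in>I. \<forall>j\<in>I. u i @ v j \<in> marked_palindromes \<longrightarrow> i = j) \<Longrightarrow> card I \<le> C * (n + 1) ^ 4"
    using heis_fooling_bound by blast
  obtain n where n: "C * (2 * n + 2) ^ 4 < (2::nat) ^ n" using exponential_exceeds_quartic by blast
  define I where "I = {xs. set xs \<subseteq> {0::nat, 1} \<and> length xs = n}"
  have "card I = 2 ^ n" unfolding I_def by (subst card_lists_length_eq) (simp_all flip: numeral_2_eq_2)
  moreover have "card I \<le> C * (2 * n + 1 + 1) ^ 4"
  proof (rule C[of I "\<lambda>x. x" "\<lambda>x. 2 # rev x"], intro conjI ballI impI)
    fix x assume "x \<in> I"
    then show "x @ 2 # rev x \<in> marked_palindromes" "length (x @ 2 # rev x) \<le> 2 * n + 1"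
      by (auto simp: I_def mem_marked_palindromes)
  next
    fix x y assume xy: "x \<in> I" "y \<in> I" "x @ 2 # rev y \<in> marked_palindromes"
    then obtain u where u: "x @ 2 # rev y = u @ 2 # rev u" unfolding mem_marked_palindromes by blast
    have len: "length x = n" "length y = n" using xy by (auto simp: I_def)
    \<comment> \<open>Equal total lengths put both centre marks at the same position, so the two
      halves can be compared separately.\<close>
    have "length u = n" using arg_cong[OF u, of length] len by simp
    then have "x = u" "rev y = rev u" using u len by simp_all
    then show "x = y" by simp
  qed
  ultimately show False using n by simp
qed

theorem theorem4p10:
  shows "(\<forall>k::nat. k \<ge> 5 \<longrightarrow>
            \<not> (lin_time_class heisenberg \<subseteq> (lin_time_class (Zk k) :: nat list set set)) \<and>
            \<not> ((lin_time_class (Zk k) :: nat list set set) \<subseteq> lin_time_class heisenberg))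
         \<and> \<not> ((lin_time_class heisenberg :: nat list set set) \<subseteq> CF)
         \<and> \<not> ((CF :: nat list set set) \<subseteq> lin_time_class heisenberg)"
proof (intro conjI allI impI)
  fix k :: nat assume k: "k \<ge> 5"
  have "heis_words \<notin> lin_time_class (Zk k)"
  proof
    assume "heis_words \<in> lin_time_class (Zk k)"
    then obtain A where "wf_gautomaton (Zk k) A" "recognizes (Zk k) A heis_words"
      unfolding lin_time_class_def by blast
    then show False
      using Zk_lengths_progression infinite_heis_words_lengths heis_words_lengths_no_progression
      by blast
  qed
  then show "\<not> (lin_time_class heisenberg \<subseteq> (lin_time_class (Zk k) :: nat list set set))"
    using heis_words_lin_time by blast
  show "\<not> ((lin_time_class (Zk k) :: nat list set set) \<subseteq> lin_time_class heisenberg)"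
    using Zk_words_lin_time[OF k] Zk_words_not_heis by blast
next
  have "heis_words \<notin> CF"
    using CF_lengths_progression infinite_heis_words_lengths heis_words_lengths_no_progression
    by blast
  then show "\<not> ((lin_time_class heisenberg :: nat list set set) \<subseteq> CF)"
    using heis_words_lin_time by blast
next
  show "\<not> ((CF :: nat list set set) \<subseteq> lin_time_class heisenberg)"
    using marked_palindromes_CF marked_palindromes_not_heis by blast
qed

end
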